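(* Consider the projective Lelieuvre map $L:\nu\to f$ for hypersurfaces in $P^{n+1}$, defined by the system of equations $$f\wedge f_{x_\alpha}=\sum_{\beta=1}^nA_{\alpha\beta}\star\left(\nu_{x_1}\wedge\dots\wedge\nu_{x_{\beta-1}}\wedge\nu\wedge\nu_{x_{\beta+1}}\wedge\dots\wedge\nu_{x_n}\right),\quad \alpha=1,\dots,n,$$ where $A_{\alpha\beta}$ ($\alpha,\beta=1,\dots,n$) are functions of $x_1,\dots,x_n$. The compatibility conditions for this map (that is, for this overdetermined system for $f$ in terms of $\nu$) are given by the system of equations $$A_{\alpha\gamma}\,\nu_{x_\beta x_\delta}-A_{\beta\delta}\,\nu_{x_\alpha x_\gamma}+\sum_{\rho=1}^nU^{(\rho)}_{\alpha,\beta,\gamma,\delta}\,\nu_{x_\rho}+W_{\alpha,\beta,\gamma,\delta}\,\nu=0,\qquad \alpha,\beta,\gamma,\delta=1,\dots,n,$$ where $U^{(\rho)}_{\alpha,\beta,\gamma,\delta}$ and $W_{\alpha,\beta,\gamma,\delta}$ are some functions.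
   Context: $f=(f_1,\dots,f_{n+2})$ and $\nu=(\nu_1,\dots,\nu_{n+2})$ are homogeneous coordinates in the dual projective spaces $P^{n+1}$ and $P_{n+1}$, paired by $\langle f,\nu\rangle=\sum_i f_i\nu_i=0$. They describe hypersurfaces $f(x_1,\dots,x_n)\subset P^{n+1}$ and $\nu(x_1,\dots,x_n)\subset P_{n+1}$, where $x_1,\dots,x_n$ are any local coordinates on the hypersurfaces; subscripts $x_\alpha$ denote partial derivatives. The matrix $A=(A_{\alpha\beta})$ has $\det A\ne0$, so that the map can be inverted. $\star$ is the Hodge star operation, and $\varepsilon$ is the totally alternating symbol on $n+2$ indices with $\varepsilon_{12\dots n+2}=1$. In components, the defining equations of the map are $$f_if_{k,x_\alpha}-f_kf_{i,x_\alpha}=\sum_{\beta=1}^nA_{\alpha\beta}\sum_{l_1,\dots,l_n}\varepsilon_{ikl_1\dots l_n}\,\nu_{l_1,x_1}\cdots\nu_{l_{\beta-1},x_{\beta-1}}\,\nu_{l_\beta}\,\nu_{l_{\beta+1},x_{\beta+1}}\cdots\nu_{l_n,x_n}$$ for $i,k=1,\dots,n+2$ and $\alpha=1,\dots,n$.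
   Formalization: That the equations suffice for local solvability is proved only where the second derivatives of ν do not all lie in the span of ν and its first derivatives, and over the reals only for A or −A; otherwise it fails (ν in a hyperplane; ν=(1,x,x²), A=−2). *)

theory Defs
  imports "HOL-Analysis.Analysis"
begin

text \<open>
  The scalar field is a type variable \<open>'k\<close> (used for the reals and the complex numbers), the local
  coordinates \<open>x\<^sub>1, \<dots>, x\<^sub>n\<close> range over an open subset of \<open>'k^'n\<close>, and homogeneous coordinates are
  vectors in \<open>'k^'m\<close>, where \<open>CARD('m) = CARD('n) + 2\<close>.  The linear orders on the two index types
  provide the numberings \<open>1, \<dots>, n\<close> and \<open>1, \<dots>, n + 2\<close>.
\<close>

subsection \<open>Partial derivatives and smoothness\<close>

definition pderiv_at :: "'n \<Rightarrow> ('k::real_normed_field^'n::finite \<Rightarrow> 'k) \<Rightarrow> 'k^'n \<Rightarrow> 'k" where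
  "pderiv_at \<alpha> g x = deriv (\<lambda>t. g (x + t *s axis \<alpha> 1)) 0"

definition pd :: "'n \<Rightarrow> ('k::real_normed_field^'n::finite \<Rightarrow> 'k^'m::finite) \<Rightarrow> 'k^'n \<Rightarrow> 'k^'m" where
  "pd \<alpha> F x = (\<chi> i. pderiv_at \<alpha> (\<lambda>y. F y $ i) x)"

text \<open>
  \<open>Ck_on k D g\<close>: all partial derivatives of \<open>g\<close> up to order \<open>k\<close> exist and are continuous on the open
  set \<open>D\<close>.  Over the complex numbers the partial derivatives are complex ones, so that smooth
  functions are the holomorphic ones.
\<close>

primrec Ck_on :: "nat \<Rightarrow> ('k::real_normed_field^'n::finite) set \<Rightarrow> ('k^'n \<Rightarrow> 'k) \<Rightarrow> bool" where
  "Ck_on 0 D g \<longleftrightarrow> continuous_on D g"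
| "Ck_on (Suc k) D g \<longleftrightarrow> continuous_on D g \<and>
     (\<forall>\<alpha>. (\<forall>x\<in>D. (\<lambda>t. g (x + t *s axis \<alpha> 1)) field_differentiable at 0) \<and>
          Ck_on k D (pderiv_at \<alpha> g))"

definition smooth_fun_on :: "('k::real_normed_field^'n::finite) set \<Rightarrow> ('k^'n \<Rightarrow> 'k) \<Rightarrow> bool" where
  "smooth_fun_on D g \<longleftrightarrow> (\<forall>k. Ck_on k D g)"

subsection \<open>The alternating symbol and the Hodge star\<close>

text \<open>
  Here \<open>card {b. b < a}\<close> is the (zero-based) number of the index \<open>a\<close>, so that the sign is that of the
  permutation taking the sorted list of all indices to \<open>ls\<close>.
\<close>

definition levi_civita :: "'m::{finite,linorder} list \<Rightarrow> 'k::comm_ring_1" where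
  "levi_civita ls =
     (if distinct ls \<and> length ls = CARD('m)
      then of_int (sign (\<lambda>a. ls ! card {b. b < a})) else 0)"

lemma card_below_less: "card {b. b < a} < CARD('m)" for a :: "'m::{finite,linorder}"
  by (rule psubset_card_mono) auto

lemma inj_card_below: "inj (\<lambda>a :: 'm::{finite,linorder}. card {b. b < a})"
proof -
  have "card {c. c < a} < card {c. c < b}" if "a < b" for a b :: 'm
    using that by (intro psubset_card_mono) (auto simp: psubset_eq set_eq_iff)
  hence "strict_mono (\<lambda>a :: 'm. card {b. b < a})" by (simp add: strict_mono_def)
  thus ?thesis by (rule strict_mono_imp_inj_on)
qed

lemma bij_card_below:
  "bij_betw (\<lambda>a :: 'm::{finite,linorder}. card {b. b < a}) UNIV {..<CARD('m)}"
proof (rule bij_betwI')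
  fix x y :: 'm show "(card {b. b < x} = card {b. b < y}) = (x = y)"
    using inj_card_below by (auto dest: injD)
next
  fix k assume k: "k \<in> {..<CARD('m)}"
  have "(\<lambda>a :: 'm. card {b. b < a}) ` UNIV = {..<CARD('m)}"
    by (rule card_subset_eq) (auto simp: card_below_less card_image[OF inj_card_below])
  thus "\<exists>x\<in>UNIV. k = card {b :: 'm. b < x}" using k by (auto simp only: image_iff)
qed (simp add: card_below_less)

lemma levi_civita_sorted:
  "levi_civita (sorted_list_of_set (UNIV :: 'm::{finite,linorder} set)) = 1"
proof -
  let ?L = "sorted_list_of_set (UNIV :: 'm set)"
  have "?L ! card {b. b < a} = a" for a
  proof -
    have "a \<in> set ?L" by simp
    then obtain k where k: "k < length ?L" "a = ?L ! k" by (auto simp only: in_set_conv_nth)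
    have "{b. b < a} = (\<lambda>j. ?L ! j) ` {..<k}" (is "?A = ?B")
    proof (intro equalityI subsetI)
      fix b assume "b \<in> ?A"
      moreover have "b \<in> set ?L" by simp
      then obtain j where j: "j < length ?L" "b = ?L ! j" by (auto simp only: in_set_conv_nth)
      moreover have "a \<le> b" if "k \<le> j"
        using sorted_nth_mono[of ?L k j] that j k by simp
      ultimately have "j < k" by (metis leD leI mem_Collect_eq)
      thus "b \<in> ?B" using j by auto
    next
      fix b assume "b \<in> ?B"
      then obtain j where j: "j < k" "b = ?L ! j" by auto
      hence "b \<le> a" "b \<noteq> a" using k
        by (auto intro!: sorted_nth_mono simp: nth_eq_iff_index_eq)
      thus "b \<in> ?A" by simp
    qed
    moreover have "inj_on (\<lambda>j. ?L ! j) {..<k}" 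
      using k by (auto intro!: inj_onI simp: nth_eq_iff_index_eq)
    ultimately show ?thesis using k by (simp add: card_image)
  qed
  hence "(\<lambda>a. ?L ! card {b. b < a}) = id" by auto
  thus ?thesis by (simp add: levi_civita_def sign_id)
qed

lemma levi_civita_swap:
  fixes ls :: "'m::{finite,linorder} list"
  assumes "i < length ls" "j < length ls" "i \<noteq> j"
  shows "levi_civita (ls[i := ls ! j, j := ls ! i]) = - (levi_civita ls :: 'k::comm_ring_1)"
proof (cases "distinct ls \<and> length ls = CARD('m)")
  case False
  thus ?thesis using assms by (auto simp: levi_civita_def)
next
  case True
  define pos where "pos = (\<lambda>a :: 'm. card {b. b < a})"
  have bij: "bij_betw pos UNIV {..<CARD('m)}" unfolding pos_def by (rule bij_card_below)
  have "i \<in> range pos" "j \<in> range pos"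
    using bij assms True by (auto simp: bij_betw_def)
  then obtain a b where ab: "pos a = i" "pos b = j" by auto
  have inj: "pos x = pos y \<longleftrightarrow> x = y" for x y
    using inj_card_below by (auto simp: pos_def dest: injD)
  have lt: "pos x < length ls" for x using True by (simp add: pos_def card_below_less)
  have eq: "(\<lambda>x. ls[i := ls ! j, j := ls ! i] ! pos x) = (\<lambda>x. ls ! pos x) \<circ> Transposition.transpose a b"
    using assms ab inj lt by (auto simp: fun_eq_iff nth_list_update Transposition.transpose_def)
  have "inj (\<lambda>x. ls ! pos x)"
    using True lt inj by (auto intro!: injI simp: nth_eq_iff_index_eq)
  hence "permutation (\<lambda>x. ls ! pos x)"
    by (simp add: permutation bij_def finite_UNIV_inj_surj)
  hence "sign ((\<lambda>x. ls ! pos x) \<circ> Transposition.transpose a b) = - sign (\<lambda>x. ls ! pos x)"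
    using assms(3) ab by (subst sign_compose) (auto simp: permutation_swap_id sign_swap_id)
  hence "sign (\<lambda>x. ls[i := ls ! j, j := ls ! i] ! card {b. b < x}) =
           - sign (\<lambda>x. ls ! card {b. b < x})"
    using eq by (simp add: pos_def)
  thus ?thesis using True assms
    by (simp add: levi_civita_def distinct_swap)
qed

text \<open>
  The component with indices \<open>i, k\<close> of \<open>\<star>(v\<^sub>1 \<and> \<dots> \<and> v\<^sub>n)\<close>; the function \<open>l\<close> is the multi-index
  \<open>l\<^sub>1, \<dots>, l\<^sub>n\<close>.
\<close>

definition hodge_star ::
    "('n::{finite,linorder} \<Rightarrow> 'k::comm_ring_1^'m::{finite,linorder}) \<Rightarrow> 'm \<Rightarrow> 'm \<Rightarrow> 'k" where
  "hodge_star v i k =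
     (\<Sum>l\<in>(UNIV :: ('n \<Rightarrow> 'm) set).
        levi_civita (i # k # map l (sorted_list_of_set UNIV)) * (\<Prod>\<rho>\<in>UNIV. v \<rho> $ l \<rho>))"

definition wedge2 :: "'k::comm_ring_1^'m::finite \<Rightarrow> 'k^'m \<Rightarrow> 'm \<Rightarrow> 'm \<Rightarrow> 'k" where
  "wedge2 a b i k = a $ i * b $ k - a $ k * b $ i"

definition pairing :: "'k::comm_ring_1^'m::finite \<Rightarrow> 'k^'m \<Rightarrow> 'k" where
  "pairing f nu = (\<Sum>i\<in>UNIV. f $ i * nu $ i)"

subsection \<open>Hypersurfaces\<close>

text \<open>
  Linear independence of \<open>\<nu>, \<nu>\<^bsub>x\<^sub>1\<^esub>, \<dots>, \<nu>\<^bsub>x\<^sub>n\<^esub>\<close> says that \<open>\<nu>\<close> is nonzero and that the map to projective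
  space with homogeneous coordinates \<open>\<nu>\<close> is an immersion.
\<close>

definition hypersurface_on ::
    "('k::real_normed_field^'n::finite) set \<Rightarrow> ('k^'n \<Rightarrow> 'k^'m::finite) \<Rightarrow> bool" where
  "hypersurface_on D nu \<longleftrightarrow>
     (\<forall>i. smooth_fun_on D (\<lambda>x. nu x $ i)) \<and>
     (\<forall>x\<in>D. \<forall>c0 c. c0 *s nu x + (\<Sum>\<rho>\<in>UNIV. c \<rho> *s pd \<rho> nu x) = 0
        \<longrightarrow> c0 = 0 \<and> (\<forall>\<rho>. c \<rho> = 0))"

text \<open>
  The second fundamental form of \<open>\<nu>\<close> vanishes at no point, i.e. \<open>\<nu>\<close> does not osculate its tangent
  hyperplane to second order.
\<close>

definition nowhere_flat_on ::
    "('k::real_normed_field^'n::finite) set \<Rightarrow> ('k^'n \<Rightarrow> 'k^'m::finite) \<Rightarrow> bool" where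
  "nowhere_flat_on D nu \<longleftrightarrow>
     (\<forall>x\<in>D. \<exists>\<alpha> \<gamma>. pd \<alpha> (pd \<gamma> nu) x \<notin> vec.span (insert (nu x) (range (\<lambda>\<rho>. pd \<rho> nu x))))"

subsection \<open>The projective Lelieuvre map\<close>

type_synonym ('k, 'n, 'm) homog_fun = "('k, 'n) vec \<Rightarrow> ('k, 'm) vec"
type_synonym ('k, 'n) matrix_fun = "('k, 'n) vec \<Rightarrow> (('k, 'n) vec, 'n) vec"

definition lelieuvre_data ::
    "('k::real_normed_field, 'n::finite) vec set \<Rightarrow> ('k, 'n) matrix_fun \<Rightarrow>
      ('k, 'n, 'm::finite) homog_fun \<Rightarrow> bool" where
  "lelieuvre_data D A nu \<longleftrightarrow> open D \<and> hypersurface_on D nu \<and>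
     (\<forall>\<alpha> \<beta>. smooth_fun_on D (\<lambda>x. A x $ \<alpha> $ \<beta>)) \<and> (\<forall>x\<in>D. det (A x) \<noteq> 0)"

definition lelieuvre_system ::
    "('k::real_normed_field, 'n::{finite,linorder}) vec set \<Rightarrow> ('k, 'n) matrix_fun \<Rightarrow>
      ('k, 'n, 'm::{finite,linorder}) homog_fun \<Rightarrow> ('k, 'n, 'm) homog_fun \<Rightarrow> bool" where
  "lelieuvre_system D A nu f \<longleftrightarrow>
     (\<forall>x\<in>D. \<forall>\<alpha> i k. wedge2 (f x) (pd \<alpha> f x) i k =
        (\<Sum>\<beta>\<in>UNIV. A x $ \<alpha> $ \<beta> *
           hodge_star (\<lambda>\<rho>. if \<rho> = \<beta> then nu x else pd \<rho> nu x) i k))"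

definition lelieuvre_image ::
    "('k::real_normed_field, 'n::{finite,linorder}) vec set \<Rightarrow> ('k, 'n) matrix_fun \<Rightarrow>
      ('k, 'n, 'm::{finite,linorder}) homog_fun \<Rightarrow> ('k, 'n, 'm) homog_fun \<Rightarrow> bool" where
  "lelieuvre_image D A nu f \<longleftrightarrow>
     hypersurface_on D f \<and> (\<forall>x\<in>D. pairing (f x) (nu x) = 0) \<and> lelieuvre_system D A nu f"

text \<open>
  Solvability is local: a solution is a multiple \<open>\<lambda> \<star>(\<nu> \<and> \<nu>\<^bsub>x\<^sub>1\<^esub> \<and> \<dots> \<and> \<nu>\<^bsub>x\<^sub>n\<^esub>)\<close>, where the data only determine
  \<open>\<lambda>\<^sup>2\<close>.
\<close>

definition lelieuvre_solvable_at ::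
    "('k::real_normed_field, 'n::{finite,linorder}) vec set \<Rightarrow> ('k, 'n) matrix_fun \<Rightarrow>
      ('k, 'n, 'm::{finite,linorder}) homog_fun \<Rightarrow> ('k, 'n) vec \<Rightarrow> bool" where
  "lelieuvre_solvable_at D A nu x \<longleftrightarrow>
     (\<exists>V f. open V \<and> x \<in> V \<and> V \<subseteq> D \<and> lelieuvre_image V A nu f)"

text \<open>
  These equations are invariant under \<open>A \<mapsto> -A\<close>, whereas the system is quadratic in \<open>f\<close>; over the reals
  they therefore determine solvability only up to the sign of \<open>A\<close>.
\<close>

definition lelieuvre_compatibility ::
    "('k::real_normed_field, 'n::finite) vec set \<Rightarrow> ('k, 'n) matrix_fun \<Rightarrow>
      ('k, 'n, 'm::finite) homog_fun \<Rightarrow> bool" where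
  "lelieuvre_compatibility D A nu \<longleftrightarrow>
     (\<exists>(U :: 'n \<Rightarrow> 'n \<Rightarrow> 'n \<Rightarrow> 'n \<Rightarrow> 'n \<Rightarrow> ('k, 'n) vec \<Rightarrow> 'k)
      (W :: 'n \<Rightarrow> 'n \<Rightarrow> 'n \<Rightarrow> 'n \<Rightarrow> ('k, 'n) vec \<Rightarrow> 'k).
        \<forall>x\<in>D. \<forall>\<alpha> \<beta> \<gamma> \<delta>.
          A x $ \<alpha> $ \<gamma> *s pd \<beta> (pd \<delta> nu) x - A x $ \<beta> $ \<delta> *s pd \<alpha> (pd \<gamma> nu) x
          + (\<Sum>\<rho>\<in>UNIV. U \<rho> \<alpha> \<beta> \<gamma> \<delta> x *s pd \<rho> nu x) + W \<alpha> \<beta> \<gamma> \<delta> x *s nu x = 0)"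

end

theory Submission
  imports Defs
begin

text \<open>
  Let \<open>\<theta>(u) = det (u, \<nu>, \<nu>\<^bsub>x\<^sub>1\<^esub>, \<dots>, \<nu>\<^bsub>x\<^sub>n\<^esub>)\<close> and \<open>h\<^bsub>\<alpha>\<gamma>\<^esub> = \<theta>(\<nu>\<^bsub>x\<^sub>\<alpha>x\<^sub>\<gamma>\<^esub>)\<close>.  Contracting the system with a pair of
  vectors \<open>(u, \<nu>)\<close> and \<open>(u, \<nu>\<^bsub>x\<^sub>\<gamma>\<^esub>)\<close> shows that a solution annihilates \<open>\<nu>\<close> and all \<open>\<nu>\<^bsub>x\<^sub>\<gamma>\<^esub>\<close>, so
  \<open>f = \<lambda> \<theta>\<close>, and that the system is then equivalent to \<open>A\<^bsub>\<alpha>\<gamma>\<^esub> = \<lambda>\<^sup>2 h\<^bsub>\<alpha>\<gamma>\<^esub>\<close>.  On the other hand \<open>\<theta>\<close> vanishes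
  exactly on the span of \<open>\<nu>, \<nu>\<^bsub>x\<^sub>1\<^esub>, \<dots>, \<nu>\<^bsub>x\<^sub>n\<^esub>\<close>, so the compatibility conditions say
  \<open>A\<^bsub>\<alpha>\<gamma>\<^esub> h\<^bsub>\<beta>\<delta>\<^esub> = A\<^bsub>\<beta>\<delta>\<^esub> h\<^bsub>\<alpha>\<gamma>\<^esub>\<close>, i.e. \<open>A = \<mu> h\<close> for a scalar function \<open>\<mu>\<close> wherever \<open>h \<noteq> 0\<close>; it has no zeros
  because \<open>det A \<noteq> 0\<close>, and \<open>\<lambda>\<close> is a local square root of \<open>\<mu>\<close> (over the reals, of \<open>\<mu>\<close> or \<open>-\<mu>\<close>).
\<close>

subsection \<open>Determinants and the Hodge star\<close>

text \<open>The list is strictly increasing, so the elements below its \<open>k\<close>-th entry are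
  exactly the \<open>k\<close> entries in front of it.\<close>

lemma sorted_list_nth_card_below:
  "sorted_list_of_set (UNIV :: 'a::{finite,linorder} set) ! card {b. b < a} = a"
proof -
  let ?L = "sorted_list_of_set (UNIV :: 'a set)"
  have "a \<in> set ?L" by simp
  then obtain k where k: "k < length ?L" "a = ?L ! k" by (auto simp only: in_set_conv_nth)
  have str: "?L ! i < ?L ! j" if "i < j" "j < length ?L" for i j
    using that strict_sorted_list_of_set[of "UNIV :: 'a set"] sorted_wrt_nth_less by blast
  have "b < a \<longleftrightarrow> b \<in> set (take k ?L)" for b
  proof
    assume "b < a"
    have "b \<in> set ?L" by simp
    then obtain j where j: "j < length ?L" "b = ?L ! j" by (auto simp only: in_set_conv_nth)
    have "j < k"
      using \<open>b < a\<close> j k str[of k j] by (metis not_less_iff_gr_or_eq)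
    thus "b \<in> set (take k ?L)" using j k by (auto simp: in_set_conv_nth)
  next
    assume "b \<in> set (take k ?L)"
    thus "b < a" using k str by (auto simp: in_set_conv_nth)
  qed
  hence "{b. b < a} = set (take k ?L)" by auto
  hence "card {b. b < a} = k" using k by (simp add: distinct_card)
  thus ?thesis using k by simp
qed

text \<open>The indices \<open>m0\<close>, \<open>m1\<close> and \<open>q \<beta>\<close> number the rows \<open>u\<close>, \<open>w\<close> and \<open>v \<beta>\<close> of the determinant \<open>vol u w v\<close>
  below.\<close>

definition row_frame :: "'m::{finite,linorder} \<Rightarrow> 'm \<Rightarrow> ('n::{finite,linorder} \<Rightarrow> 'm) \<Rightarrow> bool" where
  "row_frame m0 m1 q \<longleftrightarrow>
     card {b. b < m0} = 0 \<and> card {b. b < m1} = 1 \<and> (\<forall>\<beta>. card {b. b < q \<beta>} = card {b. b < \<beta>} + 2) \<and>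
     m0 \<noteq> m1 \<and> inj q \<and> m0 \<notin> range q \<and> m1 \<notin> range q \<and> UNIV = insert m0 (insert m1 (range q))"

text \<open>Counting smaller indices is a bijection onto \<open>{..<CARD('m)}\<close>, so the ranks
  0, 1 and \<open>card {b. b < \<beta>} + 2\<close> are all attained; by cardinality the indices
  found exhaust \<open>'m\<close>.\<close>

lemma row_frame_exists:
  assumes "CARD('m::{finite,linorder}) = CARD('n::{finite,linorder}) + 2"
  obtains m0 m1 :: "'m::{finite,linorder}" and q :: "'n::{finite,linorder} \<Rightarrow> 'm::{finite,linorder}"
  where "row_frame m0 m1 q"
proof -
  have surj: "\<exists>a :: 'm. card {b. b < a} = k" if "k < CARD('m)" for k
    using bij_card_below[where 'm = 'm] that unfolding bij_betw_def
    by (metis (no_types, lifting) imageE lessThan_iff)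
  obtain m0 :: 'm where m0: "card {b. b < m0} = 0" using surj[of 0] by auto
  obtain m1 :: 'm where m1: "card {b. b < m1} = 1" using surj[of 1] assms by auto
  have "\<forall>\<beta> :: 'n. \<exists>a :: 'm. card {b. b < a} = card {b. b < \<beta>} + 2"
    using surj card_below_less[where 'm = 'n] assms by auto
  then obtain q :: "'n \<Rightarrow> 'm" where q: "\<And>\<beta>. card {b. b < q \<beta>} = card {b. b < \<beta>} + 2"
    by metis
  have inj: "inj q"
  proof (rule injI)
    fix x y assume "q x = q y"
    hence "card {b. b < x} = card {b. b < y}" using q[of x] q[of y] by simp
    thus "x = y" using inj_card_below by (auto dest: injD)
  qed
  have ne: "m0 \<noteq> m1" "m0 \<notin> range q" "m1 \<notin> range q"
  proof -
    show "m0 \<noteq> m1" using m0 m1 by auto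
    show "m0 \<notin> range q"
    proof
      assume "m0 \<in> range q"
      then obtain b where "m0 = q b" by auto
      thus False using m0 q[of b] by simp
    qed
    show "m1 \<notin> range q"
    proof
      assume "m1 \<in> range q"
      then obtain b where "m1 = q b" by auto
      thus False using m1 q[of b] by simp
    qed
  qed
  have "card (insert m0 (insert m1 (range q))) = CARD('m)"
    using ne inj assms by (simp add: card_image)
  hence "insert m0 (insert m1 (range q)) = UNIV"
    by (intro card_subset_eq) auto
  hence "row_frame m0 m1 q" using m0 m1 q inj ne unfolding row_frame_def by auto
  thus ?thesis by (rule that)
qed

lemma row_frame_nth:
  assumes "row_frame m0 m1 (q :: 'n::{finite,linorder} \<Rightarrow> 'm::{finite,linorder})"
  shows "(x # y # map z (sorted_list_of_set UNIV)) ! card {b. b < m0} = x"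
    and "(x # y # map z (sorted_list_of_set UNIV)) ! card {b. b < m1} = y"
    and "(x # y # map z (sorted_list_of_set UNIV)) ! card {b. b < q \<beta>} = z \<beta>"
  using assms card_below_less[of \<beta>]
  by (simp_all add: row_frame_def sorted_list_nth_card_below)

lemma
  assumes "row_frame m0 m1 q"
  shows sum_row_frame: "(\<Sum>a\<in>UNIV. g a) = g m0 + (g m1 + (\<Sum>\<beta>\<in>UNIV. g (q \<beta>)))"
    and prod_row_frame: "(\<Prod>a\<in>UNIV. h a) = h m0 * (h m1 * (\<Prod>\<beta>\<in>UNIV. h (q \<beta>)))"
proof -
  have "m0 \<notin> insert m1 (range q)" "m1 \<notin> range q" "inj q" and U: "UNIV = insert m0 (insert m1 (range q))"
    using assms by (auto simp: row_frame_def)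
  thus "(\<Sum>a\<in>UNIV. g a) = g m0 + (g m1 + (\<Sum>\<beta>\<in>UNIV. g (q \<beta>)))"
    and "(\<Prod>a\<in>UNIV. h a) = h m0 * (h m1 * (\<Prod>\<beta>\<in>UNIV. h (q \<beta>)))"
    unfolding U by (simp_all add: sum.reindex prod.reindex)
qed

lemma row_frame_cases:
  assumes "row_frame m0 m1 q"
  obtains "a = m0" | "a = m1" | \<beta> where "a = q \<beta>"
  using assms unfolding row_frame_def by blast

section \<open>Determinants as alternating forms, and the components of the Hodge star\<close>

text \<open>The rows are listed in the same way as the indices in \<open>levi_civita\<close>, so
  that Leibniz' formula can be compared with \<open>hodge_star\<close> term by term. The form
  \<open>\<theta>\<close> of the introduction is \<open>vol u nu v\<close> with the partial
  derivatives of \<open>nu\<close> as \<open>v\<close>.\<close>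

definition vol ::
    "('k::comm_ring_1, 'm::{finite,linorder}) vec \<Rightarrow> ('k, 'm) vec \<Rightarrow> ('n::{finite,linorder} \<Rightarrow> ('k, 'm) vec) \<Rightarrow> 'k" where
  "vol u w v = det (\<chi> a. (u # w # map v (sorted_list_of_set UNIV)) ! card {b. b < a})"

text \<open>The pointwise independence clause of \<open>hypersurface_on\<close>, isolated so that
  the linear algebra can be done over any field.\<close>

definition frame_independent :: "'k::field^'m::finite \<Rightarrow> ('n::finite \<Rightarrow> 'k^'m) \<Rightarrow> bool" where
  "frame_independent nu v \<longleftrightarrow>
     (\<forall>c0 c. c0 *s nu + (\<Sum>\<rho>\<in>UNIV. c \<rho> *s v \<rho>) = 0 \<longrightarrow> c0 = 0 \<and> (\<forall>\<rho>. c \<rho> = 0))"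

lemma frame_independentD:
  assumes "frame_independent nu v" "c0 *s nu + (\<Sum>\<rho>\<in>UNIV. c \<rho> *s v \<rho>) = 0"
  shows "c0 = 0 \<and> (\<forall>\<rho>. c \<rho> = 0)"
  using assms unfolding frame_independent_def by blast

text \<open>Leibniz' formula, extended by zero from permutations to all maps, because
  \<open>hodge_star\<close> sums over arbitrary multi-indices.\<close>

lemma det_levi_civita:
  fixes M :: "'k::comm_ring_1^'m::finite^'m"
  shows "det M = (\<Sum>p\<in>UNIV. (if bij p then of_int (sign p) else 0) * (\<Prod>a\<in>UNIV. M $ a $ p a))"
  unfolding det_def
  by (rule sum.mono_neutral_cong_left) (auto simp: permutes_bij intro: bij_imp_permutes)

text \<open>If the first two rows are the unit vectors at \<open>i\<close> and \<open>k\<close>,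
  only those maps contribute to Leibniz' formula that send the first two rows to \<open>i\<close>
  and \<open>k\<close>. These correspond to the multi-indices \<open>l\<close>.\<close>

lemma hodge_star_eq_vol:
  fixes v :: "'n::{finite,linorder} \<Rightarrow> ('k::comm_ring_1, 'm::{finite,linorder}) vec"
  assumes "CARD('m) = CARD('n) + 2"
  shows "hodge_star v i k = vol (axis i 1) (axis k 1) v"
proof -
  obtain m0 m1 and q :: "'n \<Rightarrow> 'm" where F: "row_frame m0 m1 q"
    using row_frame_exists[OF assms] .
  \<comment> \<open>\<open>P l\<close> is the map on row indices with values \<open>i\<close>,
    \<open>k\<close>, \<open>l\<close>; its range is the set of maps that survive in the
    determinant.\<close>
  define P where "P = (\<lambda>l :: 'n \<Rightarrow> 'm. \<lambda>a :: 'm. (i # k # map l (sorted_list_of_set UNIV)) ! card {b. b < a})"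
  have P: "P l m0 = i" "P l m1 = k" "P l (q \<beta>) = l \<beta>" for l \<beta>
    unfolding P_def by (rule row_frame_nth[OF F])+
  have injP: "inj P"
    by (rule injI) (metis P(3) ext)
  have rangeP: "p \<in> range P" if "p m0 = i" "p m1 = k" for p
  proof -
    have "p a = P (p \<circ> q) a" for a
      by (cases rule: row_frame_cases[OF F, of a]) (use that P in auto)
    thus ?thesis by auto
  qed
  define R where "R = (\<lambda>a. (axis i 1 # axis k 1 # map v (sorted_list_of_set UNIV)) ! card {b :: 'm. b < a})"
  have R: "R m0 = axis i 1" "R m1 = axis k 1" "R (q \<beta>) = v \<beta>" for \<beta>
    unfolding R_def by (rule row_frame_nth[OF F])+
  \<comment> \<open>The index list has distinct entries exactly if \<open>P l\<close> is injective,
    hence bijective on the finite index type; the signs agree by definition.\<close>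
  have levi: "levi_civita (i # k # map l (sorted_list_of_set UNIV)) =
      (if bij (P l) then of_int (sign (P l)) else 0 :: 'k)" for l
  proof -
    let ?ls = "i # k # map l (sorted_list_of_set UNIV)"
    have len: "length ?ls = CARD('m)" using assms by simp
    have "distinct ?ls \<longleftrightarrow> inj_on ((!) ?ls) {..<CARD('m)}"
      using len by (metis distinct_conv_nth inj_on_nth inj_on_def lessThan_iff)
    also have "\<dots> \<longleftrightarrow> inj (((!) ?ls) \<circ> (\<lambda>a :: 'm. card {b. b < a}))"
      using bij_card_below[where 'm = 'm] inj_card_below[where 'm = 'm]
      by (metis bij_betw_def comp_inj_on_iff)
    also have "\<dots> \<longleftrightarrow> inj (P l)" by (simp add: P_def comp_def)
    also have "\<dots> \<longleftrightarrow> bij (P l)" by (auto simp: bij_def finite_UNIV_inj_surj)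
    finally show ?thesis using len unfolding levi_civita_def P_def by simp
  qed
  have "vol (axis i 1) (axis k 1) v =
      (\<Sum>p\<in>UNIV. (if bij p then of_int (sign p) else 0) * (\<Prod>a\<in>UNIV. R a $ p a))"
    unfolding vol_def det_levi_civita R_def by simp
  also have "\<dots> = (\<Sum>p\<in>range P. (if bij p then of_int (sign p) else 0) * (\<Prod>a\<in>UNIV. R a $ p a))"
  proof (rule sum.mono_neutral_right)
    show "\<forall>p\<in>UNIV - range P. (if bij p then of_int (sign p) else 0) * (\<Prod>a\<in>UNIV. R a $ p a) = 0"
    proof
      fix p assume "p \<in> UNIV - range P"
      hence "p m0 \<noteq> i \<or> p m1 \<noteq> k" using rangeP by auto
      hence "R m0 $ p m0 = 0 \<or> R m1 $ p m1 = 0" using R by (auto simp: axis_def)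
      thus "(if bij p then of_int (sign p) else 0) * (\<Prod>a\<in>UNIV. R a $ p a) = 0"
        using prod_row_frame[OF F, of "\<lambda>a. R a $ p a"] by auto
    qed
  qed auto
  also have "\<dots> = (\<Sum>l\<in>UNIV. (if bij (P l) then of_int (sign (P l)) else 0) * (\<Prod>a\<in>UNIV. R a $ P l a))"
    using injP by (simp add: sum.reindex)
  also have "\<dots> = hodge_star v i k"
    unfolding hodge_star_def levi prod_row_frame[OF F] R P by simp
  finally show ?thesis by simp
qed

text \<open>With the rows given by case distinction, the library's row operations on determinants
  apply directly.\<close>

lemma vol_frame:
  assumes "row_frame m0 m1 (q :: 'n \<Rightarrow> 'm)"
  shows "vol u w (v :: 'n::{finite,linorder} \<Rightarrow> ('k::comm_ring_1, 'm::{finite,linorder}) vec) =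
    det (\<chi> a. if a = m0 then u else if a = m1 then w else v (inv q a))"
proof -
  define R where "R = (\<lambda>a. (u # w # map v (sorted_list_of_set UNIV)) ! card {b :: 'm. b < a})"
  have R: "R m0 = u" "R m1 = w" "R (q \<beta>) = v \<beta>" for \<beta>
    unfolding R_def by (rule row_frame_nth[OF assms])+
  have "R a = (if a = m0 then u else if a = m1 then w else v (inv q a))" for a
    by (cases rule: row_frame_cases[OF assms, of a])
      (use assms in \<open>auto simp: R row_frame_def\<close>)
  thus ?thesis unfolding vol_def R_def by simp
qed

section \<open>Alternating and multilinear behaviour of the determinant form\<close>

context
  assumes card_eq: "CARD('m::{finite,linorder}) = CARD('n::{finite,linorder}) + 2"
begin

lemma vol_swap: "vol w u (v :: 'n \<Rightarrow> ('k::comm_ring_1, 'm) vec) = - vol u w v"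
proof -
  obtain m0 m1 and q :: "'n \<Rightarrow> 'm" where F: "row_frame m0 m1 q"
    using row_frame_exists[OF card_eq] .
  have ne: "m0 \<noteq> m1" using F by (simp add: row_frame_def)
  let ?M = "\<chi> a. if a = m0 then u else if a = m1 then w else v (inv q a)"
  have "(\<chi> a. if a = m0 then w else if a = m1 then u else v (inv q a)) =
      (\<chi> a. ?M $ Transposition.transpose m0 m1 a)"
    using ne by (auto simp: vec_eq_iff Transposition.transpose_def)
  thus ?thesis
    unfolding vol_frame[OF F]
    using det_permute_rows[of "Transposition.transpose m0 m1" ?M] ne
    by (simp add: permutes_swap_id sign_swap_id)
qed

text \<open>An exchange of the rows \<open>m1\<close> and \<open>q \<gamma>\<close>. It brings a
  vector that replaces \<open>v \<gamma>\<close>, as \<open>nu\<close> does in the system, back to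
  the second slot.\<close>

lemma vol_swap_upd: "vol u (v \<gamma>) (v(\<gamma> := w)) = - vol u w (v :: 'n \<Rightarrow> ('k::comm_ring_1, 'm) vec)"
proof -
  obtain m0 m1 and q :: "'n \<Rightarrow> 'm" where F: "row_frame m0 m1 q"
    using row_frame_exists[OF card_eq] .
  have ne: "m1 \<noteq> q \<gamma>" "m0 \<noteq> q \<gamma>" "m0 \<noteq> m1" and inj: "inj q" using F by (auto simp: row_frame_def)
  let ?M = "\<chi> a. if a = m0 then u else if a = m1 then w else v (inv q a)"
  have "(if a = m0 then u else if a = m1 then v \<gamma> else (v(\<gamma> := w)) (inv q a)) =
      ?M $ Transposition.transpose m1 (q \<gamma>) a" for a
    by (cases rule: row_frame_cases[OF F, of a])
      (use F ne inj in \<open>auto simp: Transposition.transpose_def row_frame_def inj_eq\<close>)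
  hence "(\<chi> a. if a = m0 then u else if a = m1 then v \<gamma> else (v(\<gamma> := w)) (inv q a)) =
      (\<chi> a. ?M $ Transposition.transpose m1 (q \<gamma>) a)"
    by presburger
  thus ?thesis
    unfolding vol_frame[OF F]
    using det_permute_rows[of "Transposition.transpose m1 (q \<gamma>)" ?M] ne
    by (simp add: permutes_swap_id sign_swap_id)
qed

lemma vol_same: "vol u u (v :: 'n \<Rightarrow> ('k::comm_ring_1, 'm) vec) = 0"
proof -
  obtain m0 m1 and q :: "'n \<Rightarrow> 'm" where F: "row_frame m0 m1 q"
    using row_frame_exists[OF card_eq] .
  show ?thesis unfolding vol_frame[OF F]
    by (rule det_identical_rows[of m0 m1]) (use F in \<open>auto simp: row_def row_frame_def\<close>)
qed

lemma vol_mem2: "vol u (v \<gamma>) (v :: 'n \<Rightarrow> ('k::comm_ring_1, 'm) vec) = 0"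
proof -
  obtain m0 m1 and q :: "'n \<Rightarrow> 'm" where F: "row_frame m0 m1 q"
    using row_frame_exists[OF card_eq] .
  show ?thesis unfolding vol_frame[OF F]
    by (rule det_identical_rows[of m1 "q \<gamma>"]) (use F in \<open>auto simp: row_def row_frame_def\<close>)
qed

lemma vol_mem1: "vol (v \<gamma>) w (v :: 'n \<Rightarrow> ('k::comm_ring_1, 'm) vec) = 0"
  using vol_swap[of w "v \<gamma>" v] vol_mem2[of w v \<gamma>] by simp

lemma vol_add: "vol (u + u') w (v :: 'n \<Rightarrow> ('k::comm_ring_1, 'm) vec) = vol u w v + vol u' w v"
proof -
  obtain m0 m1 and q :: "'n \<Rightarrow> 'm" where F: "row_frame m0 m1 q"
    using row_frame_exists[OF card_eq] .
  show ?thesis unfolding vol_frame[OF F]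
    by (rule det_row_add)
qed

lemma vol_scale: "vol (c *s u) w (v :: 'n \<Rightarrow> ('k::comm_ring_1, 'm) vec) = c * vol u w v"
proof -
  obtain m0 m1 and q :: "'n \<Rightarrow> 'm" where F: "row_frame m0 m1 q"
    using row_frame_exists[OF card_eq] .
  show ?thesis unfolding vol_frame[OF F]
    by (rule det_row_mul)
qed

lemma vol_zero: "vol 0 w (v :: 'n \<Rightarrow> ('k::comm_ring_1, 'm) vec) = 0"
  using vol_scale[of 0 0 w v] by simp

lemma vol_sum: "vol (\<Sum>i\<in>I. g i) w (v :: 'n \<Rightarrow> ('k::comm_ring_1, 'm) vec) = (\<Sum>i\<in>I. vol (g i) w v)"
  by (induction I rule: infinite_finite_induct) (simp_all add: vol_add vol_zero)

lemma vol_expand1: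
  "vol u w (v :: 'n \<Rightarrow> ('k::comm_ring_1, 'm) vec) = (\<Sum>i\<in>UNIV. u $ i * vol (axis i 1) w v)"
proof -
  have "u = (\<Sum>i\<in>UNIV. u $ i *s axis i 1)" by (simp add: basis_expansion)
  hence "vol u w v = vol (\<Sum>i\<in>UNIV. u $ i *s axis i 1) w v" by simp
  thus ?thesis by (simp add: vol_sum vol_scale)
qed

text \<open>The Hodge star components are the coefficients of the bilinear form in \<open>u\<close>
  and \<open>w\<close>. Linearity was shown in the first slot only; \<open>vol_swap\<close>
  transfers it to the second.\<close>

lemma vol_expand:
  "vol u w (v :: 'n \<Rightarrow> ('k::comm_ring_1, 'm) vec) = (\<Sum>i\<in>UNIV. \<Sum>k\<in>UNIV. u $ i * w $ k * hodge_star v i k)"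
proof -
  have "vol u w v = (\<Sum>i\<in>UNIV. u $ i * - vol w (axis i 1) v)"
    by (subst vol_expand1) (simp add: vol_swap[of _ w])
  also have "\<dots> = (\<Sum>i\<in>UNIV. u $ i * (\<Sum>k\<in>UNIV. w $ k * - vol (axis k 1) (axis i 1) v))"
    by (subst vol_expand1) (simp add: sum_negf)
  also have "\<dots> = (\<Sum>i\<in>UNIV. \<Sum>k\<in>UNIV. u $ i * w $ k * hodge_star v i k)"
    by (simp add: hodge_star_eq_vol[OF card_eq] vol_swap[symmetric] sum_distrib_left mult.assoc)
  finally show ?thesis .
qed

section \<open>The conormal form and its kernel\<close>

lemma vol_combination_eq_0:
  "vol (c0 *s nu + (\<Sum>\<rho>\<in>UNIV. c \<rho> *s v \<rho>)) nu (v :: 'n \<Rightarrow> ('k::comm_ring_1, 'm) vec) = 0"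
  by (simp add: vol_add vol_scale vol_sum vol_same vol_mem1)

text \<open>The vectors \<open>nu\<close> and \<open>v \<rho>\<close> are \<open>n + 1\<close> in
  number, so their span is a proper subspace. Any \<open>u\<close> outside it completes them to
  independent rows.\<close>

lemma vol_nonzero_exists:
  fixes nu :: "('k::field, 'm) vec" and v :: "'n \<Rightarrow> ('k, 'm) vec"
  assumes "frame_independent nu v"
  obtains u where "vol u nu v \<noteq> 0"
proof -
  obtain m0 m1 and q :: "'n \<Rightarrow> 'm" where F: "row_frame m0 m1 q"
    using row_frame_exists[OF card_eq] .
  let ?S = "insert nu (range v)"
  have "card ?S \<le> CARD('n) + 1"
    using card_image_le[of UNIV v] card_insert_le_m1[of "CARD('n) + 1" "range v" nu] by simp
  hence "vec.dim ?S < CARD('m)"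
    using vec.dim_le_card'[of ?S] card_eq by simp
  hence "vec.span ?S \<noteq> UNIV"
    by (metis less_irrefl vec.dim_span vec_dim_card)
  then obtain u where u: "u \<notin> vec.span ?S" by auto
  define R where "R = (\<lambda>a. (u # nu # map v (sorted_list_of_set UNIV)) ! card {b :: 'm. b < a})"
  have R: "R m0 = u" "R m1 = nu" "R (q \<beta>) = v \<beta>" for \<beta>
    unfolding R_def by (rule row_frame_nth[OF F])+
  have "\<forall>a. c a = 0" if c: "(\<Sum>a\<in>UNIV. c a *s R a) = 0" for c :: "'m \<Rightarrow> 'k"
  proof -
    have eq: "c m0 *s u + (c m1 *s nu + (\<Sum>\<beta>\<in>UNIV. c (q \<beta>) *s v \<beta>)) = 0"
      using c unfolding sum_row_frame[OF F] R .
    \<comment> \<open>Otherwise the relation could be solved for \<open>u\<close>, which would put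
      \<open>u\<close> into the span.\<close>
    have "c m0 = 0"
    proof (rule ccontr)
      assume n0: "c m0 \<noteq> 0"
      have "c m1 *s nu + (\<Sum>\<beta>\<in>UNIV. c (q \<beta>) *s v \<beta>) \<in> vec.span ?S"
        by (intro vec.span_add vec.span_sum vec.span_scale vec.span_base) auto
      moreover have "c m0 *s u = - (c m1 *s nu + (\<Sum>\<beta>\<in>UNIV. c (q \<beta>) *s v \<beta>))"
        using eq unfolding eq_neg_iff_add_eq_0 .
      ultimately have "c m0 *s u \<in> vec.span ?S" using vec.span_neg by metis
      hence "inverse (c m0) *s (c m0 *s u) \<in> vec.span ?S" by (rule vec.span_scale)
      thus False using u n0 by simp
    qed
    moreover from this have "c m1 = 0 \<and> (\<forall>\<beta>. c (q \<beta>) = 0)"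
      using eq by (intro frame_independentD[OF assms, of "c m1" "\<lambda>\<beta>. c (q \<beta>)"]) simp
    ultimately show ?thesis using row_frame_cases[OF F] by metis
  qed
  hence "\<exists>B. (\<chi> a. R a) ** B = mat 1"
    unfolding matrix_right_invertible_independent_rows by (auto simp: row_def)
  hence "det (\<chi> a. R a) \<noteq> 0"
    using invertible_det_nz invertible_right_inverse by blast
  hence "vol u nu v \<noteq> 0" by (simp add: vol_def R_def)
  thus ?thesis by (rule that)
qed

text \<open>A nonzero determinant makes the rows a basis; the coefficients of \<open>u\<close> solve
  the linear system with the transposed matrix.\<close>

lemma vol_decomposition:
  fixes nu :: "('k::field, 'm) vec" and v :: "'n \<Rightarrow> ('k, 'm) vec"
  assumes "vol u0 nu v \<noteq> 0"
  obtains c c0 d where "u = c *s u0 + (c0 *s nu + (\<Sum>\<rho>\<in>UNIV. d \<rho> *s v \<rho>))"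
proof -
  obtain m0 m1 and q :: "'n \<Rightarrow> 'm" where F: "row_frame m0 m1 q"
    using row_frame_exists[OF card_eq] .
  define R where "R = (\<lambda>a. (u0 # nu # map v (sorted_list_of_set UNIV)) ! card {b :: 'm. b < a})"
  have R: "R m0 = u0" "R m1 = nu" "R (q \<beta>) = v \<beta>" for \<beta>
    unfolding R_def by (rule row_frame_nth[OF F])+
  have "det (\<chi> a. R a) \<noteq> 0" using assms by (simp add: vol_def R_def)
  hence "invertible (transpose (\<chi> a. R a))"
    using invertible_det_nz det_transpose by metis
  then obtain B where "transpose (\<chi> a. R a) ** B = mat 1"
    using invertible_right_inverse by blast
  hence "transpose (\<chi> a. R a) *v (B *v u) = u"
    by (simp add: matrix_vector_mul_assoc)
  hence "u = (\<Sum>a\<in>UNIV. (B *v u) $ a *s R a)"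
    by (simp add: matrix_mult_sum column_transpose row_def column_def transpose_def)
  thus ?thesis unfolding sum_row_frame[OF F] R by (rule that)
qed

text \<open>The form kills the span, so after decomposing \<open>u\<close> only the multiple of
  \<open>u0\<close> counts. This turns statements modulo \<open>nu\<close> and its first derivatives
  into scalar equations.\<close>

lemma vol_eq_0_iff:
  fixes nu :: "('k::field, 'm) vec" and v :: "'n \<Rightarrow> ('k, 'm) vec"
  assumes "frame_independent nu v"
  shows "vol u nu v = 0 \<longleftrightarrow> (\<exists>c0 d. u = c0 *s nu + (\<Sum>\<rho>\<in>UNIV. d \<rho> *s v \<rho>))"
proof
  assume 0: "vol u nu v = 0"
  obtain u0 where u0: "vol u0 nu v \<noteq> 0" using vol_nonzero_exists[OF assms] .
  obtain c c0 d where u: "u = c *s u0 + (c0 *s nu + (\<Sum>\<rho>\<in>UNIV. d \<rho> *s v \<rho>))"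
    using vol_decomposition[OF u0] .
  have "c * vol u0 nu v = 0"
    using 0 unfolding u vol_add[of "c *s u0"] vol_combination_eq_0 vol_scale by simp
  hence "c = 0" using u0 by simp
  thus "\<exists>c0 d. u = c0 *s nu + (\<Sum>\<rho>\<in>UNIV. d \<rho> *s v \<rho>)" using u by auto
qed (auto simp: vol_combination_eq_0)

text \<open>Both linear forms vanish on the same hyperplane, hence are proportional; the factor is
  the quotient of their values at a vector \<open>u0\<close> outside it.\<close>

lemma pairing_eq_vol:
  fixes nu :: "('k::field, 'm) vec" and v :: "'n \<Rightarrow> ('k, 'm) vec"
  assumes ind: "frame_independent nu v"
    and f: "pairing f nu = 0" "\<And>\<rho>. pairing f (v \<rho>) = 0"
  obtains lam where "\<forall>u. pairing f u = lam * vol u nu v"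
proof -
  have add: "pairing f (x + y) = pairing f x + pairing f y" for x y
    by (simp add: pairing_def distrib_left sum.distrib)
  have scale: "pairing f (c *s x) = c * pairing f x" for c x
    by (simp add: pairing_def sum_distrib_left mult.left_commute)
  have "pairing f (\<Sum>\<rho>\<in>I. g \<rho>) = (\<Sum>\<rho>\<in>I. pairing f (g \<rho>))" for g and I :: "'n set"
  proof (induction I rule: infinite_finite_induct)
    case (insert i I)
    thus ?case by (simp add: add)
  qed (simp_all add: pairing_def)
  hence comb: "pairing f (c0 *s nu + (\<Sum>\<rho>\<in>UNIV. c \<rho> *s v \<rho>)) = 0" for c0 c
    by (simp add: add scale f)
  obtain u0 where u0: "vol u0 nu v \<noteq> 0" using vol_nonzero_exists[OF ind] .
  have "\<forall>u. pairing f u = pairing f u0 / vol u0 nu v * vol u nu v"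
  proof
    fix u
    obtain c c0 d where u: "u = c *s u0 + (c0 *s nu + (\<Sum>\<rho>\<in>UNIV. d \<rho> *s v \<rho>))"
      using vol_decomposition[OF u0] .
    show "pairing f u = pairing f u0 / vol u0 nu v * vol u nu v" using u0
      unfolding u add[of "c *s u0"] comb vol_add[of "c *s u0"] vol_combination_eq_0 vol_scale scale by simp
  qed
  thus ?thesis by (rule that)
qed

text \<open>Multiplying the component equations by \<open>u $ i * w $ k\<close> and summing gives a
  form of the system in which suitable vectors can be inserted.\<close>

lemma contract_wedge2:
  assumes "\<And>i k. wedge2 f g i k = (\<Sum>\<beta>\<in>UNIV. a \<beta> * hodge_star (v(\<beta> := nu)) i k)"
  shows "pairing f u * pairing g w - pairing f w * pairing g u =
    (\<Sum>\<beta>\<in>UNIV. a \<beta> * vol u w ((v :: 'n \<Rightarrow> ('k::comm_ring_1, 'm) vec)(\<beta> := nu)))"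
proof -
  have "pairing f u * pairing g w - pairing f w * pairing g u =
      (\<Sum>i\<in>UNIV. \<Sum>k\<in>UNIV. u $ i * w $ k * wedge2 f g i k)"
  proof -
    have "pairing f u * pairing g w = (\<Sum>i\<in>UNIV. \<Sum>k\<in>UNIV. u $ i * w $ k * (f $ i * g $ k))"
      by (simp add: pairing_def sum_product mult_ac)
    moreover have "pairing f w * pairing g u = (\<Sum>i\<in>UNIV. \<Sum>k\<in>UNIV. u $ i * w $ k * (f $ k * g $ i))"
      unfolding pairing_def sum_product by (subst sum.swap) (simp add: mult_ac)
    ultimately show ?thesis
      by (simp add: wedge2_def right_diff_distrib sum_subtractf)
  qed
  also have "\<dots> = (\<Sum>i\<in>UNIV. \<Sum>k\<in>UNIV. \<Sum>\<beta>\<in>UNIV. a \<beta> * (u $ i * w $ k * hodge_star (v(\<beta> := nu)) i k))"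
    by (simp add: assms sum_distrib_left mult_ac)
  also have "\<dots> = (\<Sum>i\<in>UNIV. \<Sum>\<beta>\<in>UNIV. \<Sum>k\<in>UNIV. a \<beta> * (u $ i * w $ k * hodge_star (v(\<beta> := nu)) i k))"
    by (rule sum.cong[OF refl], rule sum.swap)
  also have "\<dots> = (\<Sum>\<beta>\<in>UNIV. \<Sum>i\<in>UNIV. \<Sum>k\<in>UNIV. a \<beta> * (u $ i * w $ k * hodge_star (v(\<beta> := nu)) i k))"
    by (rule sum.swap)
  finally show ?thesis by (simp add: vol_expand sum_distrib_left)
qed

text \<open>For \<open>\<beta> \<noteq> \<gamma>\<close> the vector \<open>v \<gamma>\<close> still
  occurs among the remaining rows, so the determinant has two equal rows. The sign of the surviving
  term comes from one row exchange.\<close>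

lemma sum_vol_upd:
  "(\<Sum>\<beta>\<in>UNIV. a \<beta> * vol u (v \<gamma>) (v(\<beta> := nu))) = - (a \<gamma> * vol u nu (v :: 'n \<Rightarrow> ('k::comm_ring_1, 'm) vec))"
proof -
  have "vol u (v \<gamma>) (v(\<beta> := nu)) = (if \<beta> = \<gamma> then - vol u nu v else 0)" for \<beta>
    using vol_mem2[of u "v(\<beta> := nu)" \<gamma>] vol_swap_upd[of u v \<gamma> nu] by auto
  hence "(\<Sum>\<beta>\<in>UNIV. a \<beta> * vol u (v \<gamma>) (v(\<beta> := nu))) =
      (\<Sum>\<beta>\<in>UNIV. if \<beta> = \<gamma> then - (a \<beta> * vol u nu v) else 0)"
    by (intro sum.cong) (simp_all split: if_splits)
  thus ?thesis by simp
qed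

lemma vol_upd_same: "vol u nu ((v :: 'n \<Rightarrow> ('k::comm_ring_1, 'm) vec)(\<beta> := nu)) = 0"
  using vol_mem2[of u "v(\<beta> := nu)" \<beta>] by simp

text \<open>Two alternating forms agree as soon as they agree whenever one argument lies in a fixed
  hyperplane.\<close>

lemma wedge2_eq_hodge_star:
  fixes nu :: "('k::field, 'm) vec" and v :: "'n \<Rightarrow> ('k, 'm) vec"
  assumes ind: "frame_independent nu v"
    and f: "pairing f nu = 0" "\<And>\<rho>. pairing f (v \<rho>) = 0" and g: "pairing g nu = 0"
    and fg: "\<And>u \<gamma>. pairing f u * pairing g (v \<gamma>) = - (a \<gamma> * vol u nu v)"
  shows "wedge2 f g i k = (\<Sum>\<beta>\<in>UNIV. a \<beta> * hodge_star (v(\<beta> := nu)) i k)"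
proof -
  \<comment> \<open>\<open>C\<close> is the difference of the two sides, contracted with
    \<open>u\<close> and \<open>w\<close>; it is bilinear and alternating, and the goal is that it
    vanishes.\<close>
  define C where "C = (\<lambda>u w. (pairing f u * pairing g w - pairing f w * pairing g u) -
    (\<Sum>\<beta>\<in>UNIV. a \<beta> * vol u w (v(\<beta> := nu))))"
  have C_add: "C (u + u') w = C u w + C u' w" for u u' w
    by (simp add: C_def pairing_def vol_add distrib_left sum.distrib algebra_simps)
  have C_scale: "C (c *s u) w = c * C u w" for c u w
  proof -
    have "pairing h (c *s u) = c * pairing h u" for h
      by (simp add: pairing_def sum_distrib_left mult.left_commute)
    thus ?thesis by (simp add: C_def vol_scale sum_distrib_left algebra_simps)
  qed
  have C_sum: "C (\<Sum>\<rho>\<in>I. h \<rho>) w = (\<Sum>\<rho>\<in>I. C (h \<rho>) w)" for h w and I :: "'n set"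
  proof -
    have "C 0 w = 0" using C_scale[of 0 0 w] by simp
    thus ?thesis by (induction I rule: infinite_finite_induct) (simp_all add: C_add)
  qed
  have C_swap: "C w u = - C u w" for u w
    by (simp add: C_def vol_swap[of w u] sum_negf)
  have C_same: "C u u = 0" for u
    by (simp add: C_def vol_same)
  have C_nu: "C u nu = 0" for u
    by (simp add: C_def f g vol_upd_same)
  have C_v: "C u (v \<gamma>) = 0" for u \<gamma>
    unfolding C_def sum_vol_upd using f(2)[of \<gamma>] fg[of u \<gamma>] by simp
  have C_comb: "C (c0 *s nu + (\<Sum>\<rho>\<in>UNIV. c \<rho> *s v \<rho>)) w = 0" for c0 c w
    using C_nu[of w] C_v[of w] C_swap[of w] by (simp add: C_add C_scale C_sum)
  obtain u0 where u0: "vol u0 nu v \<noteq> 0" using vol_nonzero_exists[OF ind] .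
  \<comment> \<open>Modulo the hyperplane, which \<open>C\<close> kills, \<open>w\<close> is a
    multiple of \<open>u0\<close>; there \<open>C\<close> vanishes because it is
    alternating.\<close>
  have C_0: "C u0 w = 0" for w
  proof -
    obtain c c0 d where w: "w = c *s u0 + (c0 *s nu + (\<Sum>\<rho>\<in>UNIV. d \<rho> *s v \<rho>))"
      using vol_decomposition[OF u0] .
    have "C w u0 = 0"
      unfolding w C_add[of "c *s u0"] C_comb C_scale C_same by simp
    thus ?thesis using C_swap[of u0 w] by simp
  qed
  have "C u w = 0" for u w
  proof -
    obtain c c0 d where u: "u = c *s u0 + (c0 *s nu + (\<Sum>\<rho>\<in>UNIV. d \<rho> *s v \<rho>))"
      using vol_decomposition[OF u0] .
    show ?thesis unfolding u C_add[of "c *s u0"] C_comb C_scale C_0 by simp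
  qed
  from this[of "axis i 1" "axis k 1"] show ?thesis
    by (simp add: C_def pairing_def wedge2_def axis_def hodge_star_eq_vol[OF card_eq] if_distrib cong: if_cong)
qed

end

subsection \<open>Calculus of smooth functions\<close>

lemma coordinate_line_continuous:
  "continuous_on UNIV (\<lambda>t :: 'k::real_normed_field. x + t *s axis \<alpha> 1)"
proof -
  have "continuous_on UNIV (\<lambda>t :: 'k. \<chi> i. x $ i + t * axis \<alpha> 1 $ i)"
    by (intro continuous_intros)
  moreover have "(\<lambda>t :: 'k. \<chi> i. x $ i + t * axis \<alpha> 1 $ i) = (\<lambda>t. x + t *s axis \<alpha> 1)"
    by (simp add: fun_eq_iff vec_eq_iff)
  ultimately show ?thesis by (simp only:)
qed

lemma coordinate_line_eventually:
  assumes "open D" "x \<in> D"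
  shows "\<forall>\<^sub>F t :: 'k::real_normed_field in nhds 0. x + t *s axis \<alpha> 1 \<in> D"
proof -
  have "open ((\<lambda>t :: 'k. x + t *s axis \<alpha> 1) -` D)"
    using coordinate_line_continuous assms(1) by (metis continuous_on_open_vimage inf_top_right open_UNIV)
  thus ?thesis using assms(2) eventually_nhds_in_open by fastforce
qed

lemma pderiv_at_cong:
  assumes "open D" "x \<in> D" "\<And>y. y \<in> D \<Longrightarrow> g y = h y"
  shows "pderiv_at \<alpha> g x = pderiv_at \<alpha> h x"
  unfolding pderiv_at_def
  by (rule deriv_cong_ev) (auto intro: eventually_mono[OF coordinate_line_eventually[OF assms(1,2)]] assms(3))

text \<open>Names the differentiability clause of \<open>Ck_on\<close>: the value of
  \<open>deriv\<close> alone does not record that a derivative exists.\<close>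

definition pdiff_at :: "'n \<Rightarrow> ('k::real_normed_field^'n::finite \<Rightarrow> 'k) \<Rightarrow> 'k^'n \<Rightarrow> bool" where
  "pdiff_at \<alpha> g x \<longleftrightarrow> (\<lambda>t. g (x + t *s axis \<alpha> 1)) field_differentiable at 0"

lemma pdiff_at_cong:
  assumes "open D" "x \<in> D" "\<And>y. y \<in> D \<Longrightarrow> g y = h y" "pdiff_at \<alpha> g x"
  shows "pdiff_at \<alpha> h x"
proof -
  have ev: "\<forall>\<^sub>F t in nhds 0. h (x + t *s axis \<alpha> 1) = g (x + t *s axis \<alpha> 1)"
    by (rule eventually_mono[OF coordinate_line_eventually[OF assms(1,2), of \<alpha>]]) (simp add: assms(3))
  show ?thesis using assms(4) DERIV_cong_ev[OF refl ev refl]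
    unfolding pdiff_at_def field_differentiable_def by blast
qed

lemma has_pderiv:
  "pdiff_at \<alpha> g x \<Longrightarrow> ((\<lambda>t. g (x + t *s axis \<alpha> 1)) has_field_derivative pderiv_at \<alpha> g x) (at 0)"
  unfolding pdiff_at_def pderiv_at_def by (simp add: DERIV_deriv_iff_field_differentiable)

lemma has_pderivI:
  "((\<lambda>t. g (x + t *s axis \<alpha> 1)) has_field_derivative d) (at 0) \<Longrightarrow> pdiff_at \<alpha> g x \<and> pderiv_at \<alpha> g x = d"
  unfolding pdiff_at_def pderiv_at_def using DERIV_imp_deriv field_differentiable_def by blast

section \<open>Closure properties of functions of class \<open>Ck_on\<close>\<close>

lemma Ck_on_Suc_iff:
  "Ck_on (Suc k) D g \<longleftrightarrow>
     continuous_on D g \<and> (\<forall>\<alpha>. (\<forall>x\<in>D. pdiff_at \<alpha> g x) \<and> Ck_on k D (pderiv_at \<alpha> g))"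
  by (simp add: pdiff_at_def)

lemma Ck_on_continuous: "Ck_on k D g \<Longrightarrow> continuous_on D g"
  by (cases k) auto

lemma Ck_on_SucD: "Ck_on (Suc k) D g \<Longrightarrow> Ck_on k D g"
proof (induction k arbitrary: g)
  case (Suc k)
  thus ?case unfolding Ck_on_Suc_iff[of "Suc k"] Ck_on_Suc_iff[of k D g] by blast
qed auto

lemma Ck_on_subset: "Ck_on k D g \<Longrightarrow> V \<subseteq> D \<Longrightarrow> Ck_on k V g"
  by (induction k arbitrary: g) (auto intro: continuous_on_subset)

text \<open>On an open set, agreement on \<open>D\<close> is inherited by the partial derivatives,
  again on \<open>D\<close>; hence the induction over both functions.\<close>

lemma Ck_on_cong:
  assumes "open D"
  shows "(\<And>y. y \<in> D \<Longrightarrow> g y = h y) \<Longrightarrow> Ck_on k D g \<Longrightarrow> Ck_on k D h"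
proof (induction k arbitrary: g h)
  case 0
  thus ?case using continuous_on_cong[of D D g h] by simp
next
  case (Suc k)
  have "continuous_on D h" using Suc.prems continuous_on_cong[of D D g h] by simp
  moreover have "pdiff_at \<alpha> h x" if "x \<in> D" for \<alpha> x
    using pdiff_at_cong[OF assms that, of g h \<alpha>] Suc.prems that by (simp only: Ck_on_Suc_iff)
  moreover have "Ck_on k D (pderiv_at \<alpha> h)" for \<alpha>
  proof (rule Suc.IH)
    show "Ck_on k D (pderiv_at \<alpha> g)" using Suc.prems(2) by (simp only: Ck_on_Suc_iff)
    show "pderiv_at \<alpha> g y = pderiv_at \<alpha> h y" if "y \<in> D" for y
      by (rule pderiv_at_cong[OF assms that Suc.prems(1)])
  qed
  ultimately show ?case unfolding Ck_on_Suc_iff by blast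
qed

text \<open>Lets an explicit formula \<open>d\<close>, matching the partial derivatives on
  \<open>D\<close> only, take the place of \<open>pderiv_at\<close>.\<close>

lemma Ck_on_SucI:
  assumes "open D" "continuous_on D g"
    and "\<And>\<alpha> x. x \<in> D \<Longrightarrow> ((\<lambda>t. g (x + t *s axis \<alpha> 1)) has_field_derivative d \<alpha> x) (at 0)"
    and "\<And>\<alpha>. Ck_on k D (d \<alpha>)"
  shows "Ck_on (Suc k) D g"
  unfolding Ck_on_Suc_iff
proof (intro conjI allI ballI)
  show "Ck_on k D (pderiv_at \<alpha> g)" for \<alpha>
    by (rule Ck_on_cong[OF assms(1) _ assms(4)]) (use has_pderivI[OF assms(3)] in simp)
qed (use assms(2) has_pderivI[OF assms(3)] in auto)

lemma Ck_on_has_pderiv: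
  "Ck_on (Suc k) D g \<Longrightarrow> x \<in> D \<Longrightarrow>
     ((\<lambda>t. g (x + t *s axis \<alpha> 1)) has_field_derivative pderiv_at \<alpha> g x) (at 0)"
  unfolding Ck_on_Suc_iff using has_pderiv by blast

lemma Ck_on_const: "open D \<Longrightarrow> Ck_on k D (\<lambda>_. c)"
proof (induction k arbitrary: c)
  case (Suc k)
  show ?case
    by (rule Ck_on_SucI[where d = "\<lambda>_ _. 0"]) (simp_all only: continuous_on_const DERIV_const Suc)
qed auto

lemma Ck_on_add:
  assumes "open D"
  shows "Ck_on k D g \<Longrightarrow> Ck_on k D h \<Longrightarrow> Ck_on k D (\<lambda>x. g x + h x)"
proof (induction k arbitrary: g h)
  case (Suc k)
  show ?case
  proof (rule Ck_on_SucI[where d = "\<lambda>\<alpha> x. pderiv_at \<alpha> g x + pderiv_at \<alpha> h x"])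
    show "continuous_on D (\<lambda>x. g x + h x)"
      using Suc.prems Ck_on_continuous by (intro continuous_intros) blast+
    show "((\<lambda>t. g (x + t *s axis \<alpha> 1) + h (x + t *s axis \<alpha> 1)) has_field_derivative
        pderiv_at \<alpha> g x + pderiv_at \<alpha> h x) (at 0)" if "x \<in> D" for \<alpha> x
      by (rule DERIV_add[OF Ck_on_has_pderiv[OF Suc.prems(1) that] Ck_on_has_pderiv[OF Suc.prems(2) that]])
    show "Ck_on k D (\<lambda>x. pderiv_at \<alpha> g x + pderiv_at \<alpha> h x)" for \<alpha>
      using Suc.prems by (intro Suc.IH) (simp_all only: Ck_on_Suc_iff)
  qed fact
qed (auto intro: continuous_intros)

lemma Ck_on_mult:
  assumes "open D"
  shows "Ck_on k D g \<Longrightarrow> Ck_on k D h \<Longrightarrow> Ck_on k D (\<lambda>x. g x * h x)"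
proof (induction k arbitrary: g h)
  case (Suc k)
  show ?case
  proof (rule Ck_on_SucI[where d = "\<lambda>\<alpha> x. pderiv_at \<alpha> g x * h x + pderiv_at \<alpha> h x * g x"])
    show "continuous_on D (\<lambda>x. g x * h x)"
      using Suc.prems Ck_on_continuous by (intro continuous_intros) blast+
    show "((\<lambda>t. g (x + t *s axis \<alpha> 1) * h (x + t *s axis \<alpha> 1)) has_field_derivative
        pderiv_at \<alpha> g x * h x + pderiv_at \<alpha> h x * g x) (at 0)" if "x \<in> D" for \<alpha> x
      using DERIV_mult[OF Ck_on_has_pderiv[OF Suc.prems(1) that, of \<alpha>] Ck_on_has_pderiv[OF Suc.prems(2) that, of \<alpha>]]
      by simp
    show "Ck_on k D (\<lambda>x. pderiv_at \<alpha> g x * h x + pderiv_at \<alpha> h x * g x)" for \<alpha>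
      using Suc.prems Ck_on_SucD[OF Suc.prems(1)] Ck_on_SucD[OF Suc.prems(2)]
      by (intro Ck_on_add[OF assms] Suc.IH) (simp_all only: Ck_on_Suc_iff)
  qed fact
qed (auto intro: continuous_intros)

lemma Ck_on_inverse:
  assumes "open D" "\<And>x. x \<in> D \<Longrightarrow> g x \<noteq> 0"
  shows "Ck_on k D g \<Longrightarrow> Ck_on k D (\<lambda>x. inverse (g x))"
proof (induction k)
  case 0
  thus ?case using assms by (auto intro: continuous_intros)
next
  case (Suc k)
  show ?case
  \<comment> \<open>The derivative is written as a product of constants, a derivative of
    \<open>g\<close>, and \<open>inverse (g x)\<close> itself, which is of class \<open>k\<close> by
    induction.\<close>
  proof (rule Ck_on_SucI[where d = "\<lambda>\<alpha> x. - 1 * (pderiv_at \<alpha> g x * (inverse (g x) * inverse (g x)))"])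
    show "continuous_on D (\<lambda>x. inverse (g x))"
      using Suc.prems Ck_on_continuous assms(2) by (intro continuous_intros) blast+
    show "((\<lambda>t. inverse (g (x + t *s axis \<alpha> 1))) has_field_derivative
        - 1 * (pderiv_at \<alpha> g x * (inverse (g x) * inverse (g x)))) (at 0)" if "x \<in> D" for \<alpha> x
      using DERIV_inverse_fun[OF Ck_on_has_pderiv[OF Suc.prems that, of \<alpha>]] assms(2)[OF that]
      by (simp add: numeral_2_eq_2 mult_ac)
    show "Ck_on k D (\<lambda>x. - 1 * (pderiv_at \<alpha> g x * (inverse (g x) * inverse (g x))))" for \<alpha>
      using Suc.prems Suc.IH[OF Ck_on_SucD[OF Suc.prems]]
      by (intro Ck_on_mult[OF assms(1)] Ck_on_const assms(1)) (simp_all only: Ck_on_Suc_iff)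
  qed fact
qed

text \<open>The difference quotient of a continuous square root is that of \<open>g\<close> divided by \<open>r y + r x\<close>.\<close>

lemma DERIV_continuous_sqrt:
  fixes r g :: "'k::real_normed_field \<Rightarrow> 'k"
  assumes "(g has_field_derivative d) (at x)" "isCont r x" "r x \<noteq> 0"
    and "\<forall>\<^sub>F y in nhds x. r y * r y = g y"
  shows "(r has_field_derivative d * inverse (2 * r x)) (at x)"
proof -
  have ne: "r x + r x \<noteq> 0" using assms(3) by (metis mult_2 mult_eq_0_iff zero_neq_numeral)
  have lim: "((\<lambda>y. r y + r x) \<longlongrightarrow> r x + r x) (at x)"
    using assms(2) by (intro tendsto_intros) (simp add: isCont_def)
  have nz: "\<forall>\<^sub>F y in at x. r y + r x \<noteq> 0"
    by (rule tendsto_imp_eventually_ne[OF lim ne])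
  have sq: "\<forall>\<^sub>F y in at x. r y * r y = g y"
    using assms(4) eventually_nhds_conv_at by blast
  have gx: "r x * r x = g x" using assms(4) by (rule eventually_nhds_x_imp_x)
  have "\<forall>\<^sub>F y in at x. (g y - g x) / (y - x) / (r y + r x) = (r y - r x) / (y - x)"
    using nz sq
  proof eventually_elim
    case (elim y)
    have "(r y - r x) * (r y + r x) = r y * r y - r x * r x" by (simp add: algebra_simps)
    also have "\<dots> = g y - g x" using elim(2) gx by (simp only:)
    finally have "g y - g x = (r y - r x) * (r y + r x)" ..
    thus ?case using elim(1) by simp
  qed
  note quot = this
  have "((\<lambda>y. (g y - g x) / (y - x) / (r y + r x)) \<longlongrightarrow> d / (r x + r x)) (at x)"
    using assms(1) lim ne by (intro tendsto_divide) (simp_all add: has_field_derivative_iff)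
  hence lim': "((\<lambda>y. (r y - r x) / (y - x)) \<longlongrightarrow> d / (r x + r x)) (at x)"
    using quot by (rule Lim_transform_eventually)
  have "d / (r x + r x) = d * inverse (2 * r x)" by (simp only: divide_inverse mult_2)
  thus ?thesis using lim' unfolding has_field_derivative_iff by (simp only:)
qed

text \<open>A bootstrap: the derivative of \<open>r\<close> is that of \<open>g\<close> times
  \<open>inverse (2 * r x)\<close>, so each order of smoothness of \<open>r\<close> yields the next,
  starting from continuity.\<close>

lemma Ck_on_continuous_sqrt:
  assumes "open D" "continuous_on D r" "\<And>x. x \<in> D \<Longrightarrow> r x \<noteq> 0" "\<And>x. x \<in> D \<Longrightarrow> r x * r x = g x"
  shows "Ck_on k D g \<Longrightarrow> Ck_on k D r"
proof (induction k)
  case 0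
  thus ?case using assms by simp
next
  case (Suc k)
  show ?case
  proof (rule Ck_on_SucI[where d = "\<lambda>\<alpha> x. pderiv_at \<alpha> g x * inverse (2 * r x)"])
    show "((\<lambda>t. r (x + t *s axis \<alpha> 1)) has_field_derivative
        pderiv_at \<alpha> g x * inverse (2 * r x)) (at 0)" if "x \<in> D" for \<alpha> x
    proof -
      have "isCont (\<lambda>t. x + t *s axis \<alpha> 1) 0"
        by (rule continuous_on_eq_continuous_at[OF open_UNIV, THEN iffD1, OF coordinate_line_continuous, THEN bspec, OF UNIV_I])
      moreover have "isCont r (x + 0 *s axis \<alpha> 1)"
        using continuous_on_eq_continuous_at[OF assms(1), THEN iffD1, OF assms(2), THEN bspec, OF that]
        by (simp only: vector_smult_lzero add_0_right)
      ultimately have "isCont (\<lambda>t. r (x + t *s axis \<alpha> 1)) 0" by (rule isCont_o2)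
      moreover have "\<forall>\<^sub>F t in nhds 0. r (x + t *s axis \<alpha> 1) * r (x + t *s axis \<alpha> 1) = g (x + t *s axis \<alpha> 1)"
        by (rule eventually_mono[OF coordinate_line_eventually[OF assms(1) that]]) (rule assms(4))
      moreover have "r (x + 0 *s axis \<alpha> 1) \<noteq> 0"
        using assms(3)[OF that] by (simp only: vector_smult_lzero add_0_right not_False_eq_True)
      ultimately have "((\<lambda>t. r (x + t *s axis \<alpha> 1)) has_field_derivative
          pderiv_at \<alpha> g x * inverse (2 * r (x + 0 *s axis \<alpha> 1))) (at 0)"
        using DERIV_continuous_sqrt[OF Ck_on_has_pderiv[OF Suc.prems that, of \<alpha>],
            where r = "\<lambda>t. r (x + t *s axis \<alpha> 1)"] by blast
      thus ?thesis by (simp only: vector_smult_lzero add_0_right)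
    qed
    show "Ck_on k D (\<lambda>x. pderiv_at \<alpha> g x * inverse (2 * r x))" for \<alpha>
    proof (intro Ck_on_mult[OF assms(1)] Ck_on_inverse[OF assms(1)] Ck_on_const[OF assms(1)])
      show "Ck_on k D (pderiv_at \<alpha> g)" using Suc.prems by (simp only: Ck_on_Suc_iff)
      show "Ck_on k D r" using Suc.IH Ck_on_SucD[OF Suc.prems] by blast
      show "2 * r x \<noteq> 0" if "x \<in> D" for x using assms(3)[OF that] by simp
    qed
  qed (rule assms(1,2))+
qed

section \<open>Smooth functions, and differentiation of incidence relations\<close>

lemma smooth_fun_on_const: "open D \<Longrightarrow> smooth_fun_on D (\<lambda>_. c)"
  by (simp add: smooth_fun_on_def Ck_on_const)

lemma smooth_fun_on_add:
  "open D \<Longrightarrow> smooth_fun_on D g \<Longrightarrow> smooth_fun_on D h \<Longrightarrow> smooth_fun_on D (\<lambda>x. g x + h x)"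
  by (simp add: smooth_fun_on_def Ck_on_add)

lemma smooth_fun_on_mult:
  "open D \<Longrightarrow> smooth_fun_on D g \<Longrightarrow> smooth_fun_on D h \<Longrightarrow> smooth_fun_on D (\<lambda>x. g x * h x)"
  by (simp add: smooth_fun_on_def Ck_on_mult)

lemma smooth_fun_on_inverse:
  assumes "open D" "\<And>x. x \<in> D \<Longrightarrow> g x \<noteq> 0" "smooth_fun_on D g"
  shows "smooth_fun_on D (\<lambda>x. inverse (g x))"
  using assms Ck_on_inverse[of D g] unfolding smooth_fun_on_def by blast

lemma smooth_fun_on_continuous_sqrt:
  assumes "open D" "continuous_on D r" "\<And>x. x \<in> D \<Longrightarrow> r x \<noteq> 0" "\<And>x. x \<in> D \<Longrightarrow> r x * r x = g x"
    and "smooth_fun_on D g"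
  shows "smooth_fun_on D r"
  using assms Ck_on_continuous_sqrt[of D r g] unfolding smooth_fun_on_def by blast

lemma smooth_fun_on_subset: "smooth_fun_on D g \<Longrightarrow> V \<subseteq> D \<Longrightarrow> smooth_fun_on V g"
  unfolding smooth_fun_on_def using Ck_on_subset by blast

lemma smooth_fun_on_continuous: "smooth_fun_on D g \<Longrightarrow> continuous_on D g"
  unfolding smooth_fun_on_def using Ck_on_continuous by blast

lemma smooth_fun_on_pderiv_at: "smooth_fun_on D g \<Longrightarrow> smooth_fun_on D (pderiv_at \<alpha> g)"
  unfolding smooth_fun_on_def using Ck_on_Suc_iff by blast

lemma smooth_fun_on_sum:
  "open D \<Longrightarrow> (\<And>i. i \<in> I \<Longrightarrow> smooth_fun_on D (g i)) \<Longrightarrow> smooth_fun_on D (\<lambda>x. \<Sum>i\<in>I. g i x)"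
  by (induction I rule: infinite_finite_induct)
    (auto intro: smooth_fun_on_const smooth_fun_on_add)

lemma smooth_fun_on_prod:
  "open D \<Longrightarrow> (\<And>i. i \<in> I \<Longrightarrow> smooth_fun_on D (g i)) \<Longrightarrow> smooth_fun_on D (\<lambda>x. \<Prod>i\<in>I. g i x)"
  by (induction I rule: infinite_finite_induct)
    (auto intro: smooth_fun_on_const smooth_fun_on_mult)

lemma smooth_fun_on_has_pderiv:
  "smooth_fun_on D g \<Longrightarrow> x \<in> D \<Longrightarrow>
     ((\<lambda>t. g (x + t *s axis \<alpha> 1)) has_field_derivative pderiv_at \<alpha> g x) (at 0)"
  unfolding smooth_fun_on_def using Ck_on_has_pderiv by blast

lemma smooth_fun_on_det:
  fixes M :: "'k::real_normed_field^'n::finite \<Rightarrow> 'k^'m::finite^'m"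
  assumes "open D" "\<And>a b. smooth_fun_on D (\<lambda>x. M x $ a $ b)"
  shows "smooth_fun_on D (\<lambda>x. det (M x))"
  unfolding det_def
  by (intro smooth_fun_on_sum smooth_fun_on_mult smooth_fun_on_prod smooth_fun_on_const assms)

text \<open>The product rule applied to the vanishing pairing. It is also used with a partial
  derivative \<open>pd \<gamma> nu\<close> in the role of \<open>nu\<close>.\<close>

lemma pairing_pd:
  assumes "open D" "x \<in> D" "\<And>i. smooth_fun_on D (\<lambda>x. f x $ i)" "\<And>i. smooth_fun_on D (\<lambda>x. nu x $ i)"
    and "\<And>y. y \<in> D \<Longrightarrow> pairing (f y) (nu y) = 0"
  shows "pairing (pd \<alpha> f x) (nu x) = - pairing (f x) (pd \<alpha> nu x)"
proof -
  have "((\<lambda>t. pairing (f (x + t *s axis \<alpha> 1)) (nu (x + t *s axis \<alpha> 1))) has_field_derivative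
      pairing (pd \<alpha> f x) (nu x) + pairing (f x) (pd \<alpha> nu x)) (at 0)"
    unfolding pairing_def sum.distrib[symmetric]
  proof (rule DERIV_sum)
    fix i
    show "((\<lambda>t. f (x + t *s axis \<alpha> 1) $ i * nu (x + t *s axis \<alpha> 1) $ i) has_field_derivative
        pd \<alpha> f x $ i * nu x $ i + f x $ i * pd \<alpha> nu x $ i) (at 0)"
      using DERIV_mult[OF smooth_fun_on_has_pderiv[OF assms(3)[of i] assms(2), of \<alpha>]
          smooth_fun_on_has_pderiv[OF assms(4)[of i] assms(2), of \<alpha>]]
      by (simp only: pd_def vec_lambda_beta vector_smult_lzero add_0_right mult.commute)
  qed
  moreover have "((\<lambda>t. pairing (f (x + t *s axis \<alpha> 1)) (nu (x + t *s axis \<alpha> 1))) has_field_derivative 0) (at 0)"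
  proof -
    have "\<forall>\<^sub>F t in nhds 0. pairing (f (x + t *s axis \<alpha> 1)) (nu (x + t *s axis \<alpha> 1)) = 0"
      by (rule eventually_mono[OF coordinate_line_eventually[OF assms(1,2)]]) (rule assms(5))
    from DERIV_cong_ev[OF refl this refl] show ?thesis using DERIV_const by (rule iffD2)
  qed
  ultimately have "pairing (pd \<alpha> f x) (nu x) + pairing (f x) (pd \<alpha> nu x) = 0"
    by (rule DERIV_unique)
  thus ?thesis by (simp add: eq_neg_iff_add_eq_0)
qed

lemma smooth_fun_on_vol:
  fixes u w :: "('k::real_normed_field, 'd::finite) vec \<Rightarrow> ('k, 'm::{finite,linorder}) vec"
    and v :: "'n::{finite,linorder} \<Rightarrow> ('k, 'd) vec \<Rightarrow> ('k, 'm) vec"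
  assumes "CARD('m) = CARD('n) + 2" "open D"
    and "\<And>i. smooth_fun_on D (\<lambda>x. u x $ i)" "\<And>i. smooth_fun_on D (\<lambda>x. w x $ i)"
    and "\<And>\<rho> i. smooth_fun_on D (\<lambda>x. v \<rho> x $ i)"
  shows "smooth_fun_on D (\<lambda>x. vol (u x) (w x) (\<lambda>\<rho>. v \<rho> x))"
proof -
  obtain m0 m1 and q :: "'n \<Rightarrow> 'm" where F: "row_frame m0 m1 q"
    using row_frame_exists[OF assms(1)] .
  have "smooth_fun_on D (\<lambda>x. (if a = m0 then u x else if a = m1 then w x else v (inv q a) x) $ b)" for a b
    using assms(3-5) by (cases "a = m0"; cases "a = m1") simp_all
  thus ?thesis
    unfolding vol_frame[OF F] by (intro smooth_fun_on_det assms(2)) simp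
qed

lemma smooth_fun_on_pd:
  "(\<And>i. smooth_fun_on D (\<lambda>x. F x $ i)) \<Longrightarrow> smooth_fun_on D (\<lambda>x. pd \<alpha> F x $ i)"
  unfolding pd_def vec_lambda_beta by (rule smooth_fun_on_pderiv_at)

subsection \<open>The Lelieuvre system and the second fundamental form\<close>

lemma hypersurface_on_subset: "hypersurface_on D nu \<Longrightarrow> V \<subseteq> D \<Longrightarrow> hypersurface_on V nu"
  by (auto simp: hypersurface_on_def intro: smooth_fun_on_subset)

lemma hypersurface_on_smooth: "hypersurface_on D nu \<Longrightarrow> smooth_fun_on D (\<lambda>x. nu x $ i)"
  by (simp add: hypersurface_on_def)

lemma hypersurface_on_independent:
  "hypersurface_on D nu \<Longrightarrow> x \<in> D \<Longrightarrow> frame_independent (nu x) (\<lambda>\<rho>. pd \<rho> nu x)"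
  by (simp add: hypersurface_on_def frame_independent_def)

lemma pairing_axis: "pairing f (axis i 1) = (f $ i :: 'k::comm_ring_1)"
  by (simp add: pairing_def axis_def if_distrib cong: if_cong)

lemma pairing_add_left: "pairing (f + g) w = pairing f w + pairing g w"
  by (simp add: pairing_def distrib_right sum.distrib)

lemma pairing_scale_left: "pairing (c *s f) w = c * pairing f w"
  by (simp add: pairing_def sum_distrib_left mult.assoc)

lemma pairing_sum_left: "pairing (\<Sum>i\<in>I. g i) w = (\<Sum>i\<in>I. pairing (g i) w)"
proof (induction I rule: infinite_finite_induct)
  case (insert i I)
  thus ?case by (simp add: pairing_add_left)
qed (simp_all add: pairing_def)

text \<open>The components of the second fundamental form of \<open>\<nu>\<close>, for the conormal
  \<open>\<star>(\<nu> \<and> \<nu>\<^bsub>x\<^sub>1\<^esub> \<and> \<dots> \<and> \<nu>\<^bsub>x\<^sub>n\<^esub>)\<close>.\<close>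

definition second_form ::
    "('k::real_normed_field, 'n::{finite,linorder}, 'm::{finite,linorder}) homog_fun \<Rightarrow>
      ('k, 'n) vec \<Rightarrow> 'n \<Rightarrow> 'n \<Rightarrow> 'k" where
  "second_form nu x \<alpha> \<gamma> = vol (pd \<alpha> (pd \<gamma> nu) x) (nu x) (\<lambda>\<rho>. pd \<rho> nu x)"

section \<open>Solvability implies compatibility\<close>

context
  assumes card_eq: "CARD('m::{finite,linorder}) = CARD('n::{finite,linorder}) + 2"
begin

lemma lelieuvre_image_second_form:
  fixes nu f :: "('k::real_normed_field, 'n, 'm) homog_fun"
  assumes "open V" "hypersurface_on V nu" "lelieuvre_image V A nu f" "x \<in> V"
  obtains lam where "\<forall>\<alpha> \<gamma>. A x $ \<alpha> $ \<gamma> = lam * lam * second_form nu x \<alpha> \<gamma>"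
proof -
  have hf: "hypersurface_on V f" and f_nu: "\<And>y. y \<in> V \<Longrightarrow> pairing (f y) (nu y) = 0"
    using assms(3) by (auto simp: lelieuvre_image_def)
  note sm = hypersurface_on_smooth[OF hf] hypersurface_on_smooth[OF assms(2)]
  have wedge: "wedge2 (f y) (pd \<alpha> f y) i k =
      (\<Sum>\<beta>\<in>UNIV. A y $ \<alpha> $ \<beta> * hodge_star ((\<lambda>\<rho>. pd \<rho> nu y)(\<beta> := nu y)) i k)" if "y \<in> V" for y \<alpha> i k
    using assms(3) that unfolding lelieuvre_image_def lelieuvre_system_def fun_upd_def by blast
  have contract: "pairing (f y) u * pairing (pd \<alpha> f y) w - pairing (f y) w * pairing (pd \<alpha> f y) u =
      (\<Sum>\<beta>\<in>UNIV. A y $ \<alpha> $ \<beta> * vol u w ((\<lambda>\<rho>. pd \<rho> nu y)(\<beta> := nu y)))" if "y \<in> V" for y \<alpha> u w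
    by (rule contract_wedge2[OF card_eq wedge[OF that]])
  have f_ne: "\<exists>u. pairing (f y) u \<noteq> 0" if "y \<in> V" for y
  proof (rule ccontr)
    assume "\<not> ?thesis"
    hence "f y = 0" using pairing_axis[of "f y"] by (simp add: vec_eq_iff)
    hence "1 *s f y + (\<Sum>\<rho>\<in>UNIV. 0 *s pd \<rho> f y) = 0" by simp
    from frame_independentD[OF hypersurface_on_independent[OF hf that] this] show False by simp
  qed
  \<comment> \<open>Contraction with \<open>u\<close> and \<open>nu y\<close>: the right side
    vanishes by equal rows and one term on the left by incidence, leaving a product whose first
    factor is nonzero.\<close>
  have df_nu: "pairing (pd \<alpha> f y) (nu y) = 0" if y: "y \<in> V" for y \<alpha>
  proof -
    obtain u where u: "pairing (f y) u \<noteq> 0" using f_ne[OF y] by blast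
    have "pairing (f y) u * pairing (pd \<alpha> f y) (nu y) = 0"
      using contract[OF y, of u \<alpha> "nu y"] f_nu[OF y] by (simp add: vol_upd_same[OF card_eq])
    thus ?thesis using u by simp
  qed
  have f_dnu: "pairing (f y) (pd \<alpha> nu y) = 0" if "y \<in> V" for y \<alpha>
    using pairing_pd[OF assms(1) that sm f_nu] df_nu[OF that, of \<alpha>] by simp
  \<comment> \<open>Differentiates \<open>f_dnu\<close>; this is why the incidence relations above
    were proved on all of \<open>V\<close> and not just at \<open>x\<close>.\<close>
  have df_dnu: "pairing (pd \<alpha> f x) (pd \<gamma> nu x) = - pairing (f x) (pd \<alpha> (pd \<gamma> nu) x)" for \<alpha> \<gamma>
    by (rule pairing_pd[OF assms(1,4) sm(1) smooth_fun_on_pd[OF sm(2)] f_dnu])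
  note ind = hypersurface_on_independent[OF assms(2,4)]
  obtain lam where "\<forall>u. pairing (f x) u = lam * vol u (nu x) (\<lambda>\<rho>. pd \<rho> nu x)"
    by (rule pairing_eq_vol[OF card_eq ind f_nu[OF assms(4)] f_dnu[OF assms(4)]])
  hence lam: "pairing (f x) u = lam * vol u (nu x) (\<lambda>\<rho>. pd \<rho> nu x)" for u ..
  obtain u where u: "vol u (nu x) (\<lambda>\<rho>. pd \<rho> nu x) \<noteq> 0"
    by (rule vol_nonzero_exists[OF card_eq ind])
  have "A x $ \<alpha> $ \<gamma> = lam * lam * second_form nu x \<alpha> \<gamma>" for \<alpha> \<gamma>
  proof -
    \<comment> \<open>Contraction with \<open>u\<close> and \<open>pd \<gamma> nu x\<close> isolates
      a single entry of \<open>A\<close>.\<close>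
    have "pairing (f x) u * pairing (pd \<alpha> f x) (pd \<gamma> nu x) =
        - (A x $ \<alpha> $ \<gamma> * vol u (nu x) (\<lambda>\<rho>. pd \<rho> nu x))"
      using contract[OF assms(4), of u \<alpha> "pd \<gamma> nu x"] f_dnu[OF assms(4)]
        sum_vol_upd[OF card_eq, of "\<lambda>\<beta>. A x $ \<alpha> $ \<beta>" u "\<lambda>\<rho>. pd \<rho> nu x" \<gamma> "nu x"] by simp
    hence "lam * vol u (nu x) (\<lambda>\<rho>. pd \<rho> nu x) * (lam * second_form nu x \<alpha> \<gamma>) =
        A x $ \<alpha> $ \<gamma> * vol u (nu x) (\<lambda>\<rho>. pd \<rho> nu x)"
      unfolding df_dnu lam second_form_def by simp
    thus ?thesis using u by (simp add: mult.assoc)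
  qed
  thus ?thesis by (intro that allI)
qed

text \<open>If \<open>A\<close> is a multiple of the second form, the form \<open>vol\<close>
  vanishes on the leading terms of each condition, which therefore lie in the span. Their
  coefficients there, negated, serve as \<open>U\<close> and \<open>W\<close>.\<close>

lemma lelieuvre_compatibilityI:
  fixes nu :: "('k::real_normed_field, 'n, 'm) homog_fun"
  assumes "hypersurface_on D nu"
    and "\<And>x. x \<in> D \<Longrightarrow> \<exists>mu. \<forall>\<alpha> \<gamma>. A x $ \<alpha> $ \<gamma> = mu * second_form nu x \<alpha> \<gamma>"
  shows "lelieuvre_compatibility D A nu"
proof -
  \<comment> \<open>The coefficients are paired so that one choice at each point and index tuple
    supplies both \<open>W\<close> (first component) and \<open>U\<close> (second
    component).\<close>
  define S where "S = (\<lambda>x \<alpha> \<beta> \<gamma> \<delta> (w, u).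
    A x $ \<alpha> $ \<gamma> *s pd \<beta> (pd \<delta> nu) x - A x $ \<beta> $ \<delta> *s pd \<alpha> (pd \<gamma> nu) x
      + (\<Sum>\<rho>\<in>UNIV. u \<rho> *s pd \<rho> nu x) + w *s nu x = 0)"
  define p where "p = (\<lambda>x \<alpha> \<beta> \<gamma> \<delta>. SOME p. S x \<alpha> \<beta> \<gamma> \<delta> p)"
  have S: "S x \<alpha> \<beta> \<gamma> \<delta> (p x \<alpha> \<beta> \<gamma> \<delta>)" if x: "x \<in> D" for x \<alpha> \<beta> \<gamma> \<delta>
  proof -
    \<comment> \<open>The difference is written as a sum with a negated scalar, so that
      \<open>vol_add\<close> and \<open>vol_scale\<close> apply.\<close>
    let ?z = "A x $ \<alpha> $ \<gamma> *s pd \<beta> (pd \<delta> nu) x + (- (A x $ \<beta> $ \<delta>)) *s pd \<alpha> (pd \<gamma> nu) x"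
    obtain mu where mu: "\<forall>\<alpha> \<gamma>. A x $ \<alpha> $ \<gamma> = mu * second_form nu x \<alpha> \<gamma>"
      using assms(2)[OF x] by (elim exE)
    have "vol ?z (nu x) (\<lambda>\<rho>. pd \<rho> nu x) =
        A x $ \<alpha> $ \<gamma> * second_form nu x \<beta> \<delta> + (- (A x $ \<beta> $ \<delta>)) * second_form nu x \<alpha> \<gamma>"
      by (simp only: vol_add[OF card_eq] vol_scale[OF card_eq] second_form_def)
    also have "\<dots> = 0" by (simp add: mu)
    finally obtain c0 d where z: "?z = c0 *s nu x + (\<Sum>\<rho>\<in>UNIV. d \<rho> *s pd \<rho> nu x)"
      unfolding vol_eq_0_iff[OF card_eq hypersurface_on_independent[OF assms(1) x]] by (elim exE)
    have "A x $ \<alpha> $ \<gamma> *s pd \<beta> (pd \<delta> nu) x - A x $ \<beta> $ \<delta> *s pd \<alpha> (pd \<gamma> nu) x = ?z"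
      by (simp add: vec_eq_iff)
    hence "S x \<alpha> \<beta> \<gamma> \<delta> (- c0, \<lambda>\<rho>. - d \<rho>)"
      unfolding S_def z by (simp add: vec_eq_iff sum_negf)
    thus ?thesis unfolding p_def by (rule someI)
  qed
  show ?thesis
    unfolding lelieuvre_compatibility_def
  proof (rule exI, rule exI, intro ballI allI)
    fix x \<alpha> \<beta> \<gamma> \<delta> assume "x \<in> D"
    show "A x $ \<alpha> $ \<gamma> *s pd \<beta> (pd \<delta> nu) x - A x $ \<beta> $ \<delta> *s pd \<alpha> (pd \<gamma> nu) x
        + (\<Sum>\<rho>\<in>UNIV. (\<lambda>\<rho> \<alpha> \<beta> \<gamma> \<delta> x. snd (p x \<alpha> \<beta> \<gamma> \<delta>) \<rho>) \<rho> \<alpha> \<beta> \<gamma> \<delta> x *s pd \<rho> nu x)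
        + (\<lambda>\<alpha> \<beta> \<gamma> \<delta> x. fst (p x \<alpha> \<beta> \<gamma> \<delta>)) \<alpha> \<beta> \<gamma> \<delta> x *s nu x = 0"
      using S[OF \<open>x \<in> D\<close>, of \<alpha> \<beta> \<gamma> \<delta>] by (simp add: S_def case_prod_unfold)
  qed
qed

text \<open>The conditions at \<open>x\<close> are read off from any solution near \<open>x\<close>,
  with \<open>lam * lam\<close> as the factor \<open>mu\<close>.\<close>

lemma solvable_imp_compatibility:
  fixes nu :: "('k::real_normed_field, 'n, 'm) homog_fun"
  assumes "lelieuvre_data D A nu" "\<forall>x\<in>D. lelieuvre_solvable_at D A nu x"
  shows "lelieuvre_compatibility D A nu"
proof (rule lelieuvre_compatibilityI)
  show hnu: "hypersurface_on D nu" using assms(1) by (simp add: lelieuvre_data_def)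
  fix x assume "x \<in> D"
  then obtain V f where V: "open V" "x \<in> V" "V \<subseteq> D" "lelieuvre_image V A nu f"
    using assms(2) unfolding lelieuvre_solvable_at_def by blast
  show "\<exists>mu. \<forall>\<alpha> \<gamma>. A x $ \<alpha> $ \<gamma> = mu * second_form nu x \<alpha> \<gamma>"
    by (rule lelieuvre_image_second_form[OF V(1) hypersurface_on_subset[OF hnu V(3)] V(4,2)]) (rule exI)
qed

section \<open>Compatibility implies local solvability\<close>

text \<open>The candidate is \<open>lam\<close> times the conormal, whose \<open>i\<close>-th
  component is the form \<open>vol\<close> at the \<open>i\<close>-th unit vector. The computation
  for a given solution is run backwards.\<close>

lemma lelieuvre_image_conormal:
  fixes nu :: "('k::real_normed_field, 'n, 'm) homog_fun"
  assumes V: "open V" and hnu: "hypersurface_on V nu"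
    and det: "\<And>y. y \<in> V \<Longrightarrow> det (A y) \<noteq> 0"
    and lam: "smooth_fun_on V lam" "\<And>y. y \<in> V \<Longrightarrow> lam y \<noteq> 0"
    and A: "\<And>y \<alpha> \<gamma>. y \<in> V \<Longrightarrow> A y $ \<alpha> $ \<gamma> = lam y * lam y * second_form nu y \<alpha> \<gamma>"
  shows "lelieuvre_image V A nu (\<lambda>y. \<chi> i. lam y * vol (axis i 1) (nu y) (\<lambda>\<rho>. pd \<rho> nu y))"
    (is "lelieuvre_image V A nu ?f")
proof -
  define f where "f = ?f"
  note sm_nu = hypersurface_on_smooth[OF hnu]
  have sm_f: "smooth_fun_on V (\<lambda>y. f y $ i)" for i
    unfolding f_def vec_lambda_beta
    by (intro smooth_fun_on_mult[OF V] lam smooth_fun_on_vol[OF card_eq V] smooth_fun_on_const[OF V] sm_nu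
        smooth_fun_on_pd)
  have f_vol: "pairing (f y) u = lam y * vol u (nu y) (\<lambda>\<rho>. pd \<rho> nu y)" for y u
    by (simp add: f_def pairing_def vol_expand1[OF card_eq, of u] sum_distrib_left mult_ac)
  have f_nu: "pairing (f y) (nu y) = 0" for y
    by (simp add: f_vol vol_same[OF card_eq])
  have f_dnu: "pairing (f y) (pd \<rho> nu y) = 0" for y \<rho>
    using vol_mem1[OF card_eq, of "\<lambda>\<rho>. pd \<rho> nu y" \<rho> "nu y"] by (simp add: f_vol)
  have df_nu: "pairing (pd \<alpha> f y) (nu y) = 0" if "y \<in> V" for y \<alpha>
    using pairing_pd[OF V that sm_f sm_nu f_nu, of \<alpha>] f_dnu by simp
  have df_dnu: "pairing (pd \<alpha> f y) (pd \<gamma> nu y) = - (lam y * second_form nu y \<alpha> \<gamma>)" if "y \<in> V" for y \<alpha> \<gamma>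
    using pairing_pd[OF V that sm_f smooth_fun_on_pd[OF sm_nu] f_dnu, of \<alpha>]
    by (simp add: f_vol second_form_def)
  have "hypersurface_on V f"
    unfolding hypersurface_on_def
  proof (intro conjI allI ballI impI)
    fix y c0 c assume y: "y \<in> V" and eq: "c0 *s f y + (\<Sum>\<rho>\<in>UNIV. c \<rho> *s pd \<rho> f y) = 0"
    \<comment> \<open>Pairing the relation with \<open>pd \<gamma> nu y\<close> removes
      \<open>f y\<close>; one more factor \<open>lam y\<close> turns the second form into
      \<open>A\<close>. So the \<open>c \<rho>\<close> give a relation between the rows of the
      invertible matrix \<open>A y\<close>.\<close>
    have "(\<Sum>\<rho>\<in>UNIV. c \<rho> * A y $ \<rho> $ \<gamma>) = 0" for \<gamma>
    proof -
      have "0 = pairing (c0 *s f y + (\<Sum>\<rho>\<in>UNIV. c \<rho> *s pd \<rho> f y)) (pd \<gamma> nu y)"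
        unfolding eq by (simp add: pairing_def)
      also have "\<dots> = - (\<Sum>\<rho>\<in>UNIV. c \<rho> * (lam y * second_form nu y \<rho> \<gamma>))"
        using y by (simp add: pairing_add_left pairing_scale_left pairing_sum_left f_dnu df_dnu sum_negf)
      finally have "lam y * (\<Sum>\<rho>\<in>UNIV. c \<rho> * (lam y * second_form nu y \<rho> \<gamma>)) = 0" by simp
      thus ?thesis using y by (simp add: A sum_distrib_left mult_ac)
    qed
    hence "(\<Sum>\<rho>\<in>UNIV. c \<rho> *s row \<rho> (A y)) = 0" by (simp add: vec_eq_iff row_def)
    moreover have "\<exists>B. A y ** B = mat 1"
      using det[OF y] invertible_det_nz invertible_right_inverse by blast
    ultimately show c: "c \<rho> = 0" for \<rho>
      unfolding matrix_right_invertible_independent_rows by blast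
    obtain u where u: "vol u (nu y) (\<lambda>\<rho>. pd \<rho> nu y) \<noteq> 0"
      by (rule vol_nonzero_exists[OF card_eq hypersurface_on_independent[OF hnu y]])
    have "c0 *s f y = 0" using eq c by simp
    hence "pairing (c0 *s f y) u = 0" by (simp only:) (simp add: pairing_def)
    hence "c0 * pairing (f y) u = 0" by (simp only: pairing_scale_left)
    thus "c0 = 0" using u lam(2)[OF y] by (simp add: f_vol)
  qed (rule sm_f)
  moreover have "lelieuvre_system V A nu f"
    unfolding lelieuvre_system_def
  proof (intro ballI allI)
    fix y \<alpha> i k assume y: "y \<in> V"
    have "wedge2 (f y) (pd \<alpha> f y) i k =
        (\<Sum>\<beta>\<in>UNIV. A y $ \<alpha> $ \<beta> * hodge_star ((\<lambda>\<rho>. pd \<rho> nu y)(\<beta> := nu y)) i k)"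
      by (rule wedge2_eq_hodge_star[OF card_eq hypersurface_on_independent[OF hnu y] f_nu f_dnu df_nu[OF y]])
        (simp add: f_vol df_dnu[OF y] A[OF y])
    thus "wedge2 (f y) (pd \<alpha> f y) i k = (\<Sum>\<beta>\<in>UNIV. A y $ \<alpha> $ \<beta> *
        hodge_star (\<lambda>\<rho>. if \<rho> = \<beta> then nu y else pd \<rho> nu y) i k)"
      by (simp add: fun_upd_def)
  qed
  ultimately show ?thesis
    unfolding lelieuvre_image_def using f_nu by (simp add: f_def)
qed

text \<open>Some entry of the second form is nonzero at \<open>x\<close>, hence near
  \<open>x\<close>. Comparing all other entries with this one shows that \<open>mu\<close> is the
  quotient of the corresponding entries of \<open>A\<close> and the second form, which is
  smooth.\<close>

lemma compatibility_factor:
  fixes nu :: "('k::real_normed_field, 'n, 'm) homog_fun"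
  assumes data: "lelieuvre_data D A nu" and flat: "nowhere_flat_on D nu"
    and comp: "lelieuvre_compatibility D A nu" and x: "x \<in> D"
  obtains V mu where "open V" "x \<in> V" "V \<subseteq> D" "smooth_fun_on V mu" "\<forall>y\<in>V. mu y \<noteq> 0"
    "\<forall>y\<in>V. \<forall>\<alpha> \<gamma>. A y $ \<alpha> $ \<gamma> = mu y * second_form nu y \<alpha> \<gamma>"
proof -
  have D: "open D" and hnu: "hypersurface_on D nu"
    and sm_A: "\<And>\<alpha> \<beta>. smooth_fun_on D (\<lambda>x. A x $ \<alpha> $ \<beta>)" and det: "\<And>x. x \<in> D \<Longrightarrow> det (A x) \<noteq> 0"
    using data by (auto simp: lelieuvre_data_def)
  note sm_nu = hypersurface_on_smooth[OF hnu]
  obtain \<alpha>0 \<gamma>0 where notin: "pd \<alpha>0 (pd \<gamma>0 nu) x \<notin> vec.span (insert (nu x) (range (\<lambda>\<rho>. pd \<rho> nu x)))"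
    using flat x unfolding nowhere_flat_on_def by blast
  let ?H = "\<lambda>y. second_form nu y \<alpha>0 \<gamma>0"
  have Hx: "?H x \<noteq> 0"
  proof
    assume "?H x = 0"
    then obtain c0 d where "pd \<alpha>0 (pd \<gamma>0 nu) x = c0 *s nu x + (\<Sum>\<rho>\<in>UNIV. d \<rho> *s pd \<rho> nu x)"
      unfolding second_form_def vol_eq_0_iff[OF card_eq hypersurface_on_independent[OF hnu x]]
      by (elim exE)
    moreover have "c0 *s nu x + (\<Sum>\<rho>\<in>UNIV. d \<rho> *s pd \<rho> nu x)
        \<in> vec.span (insert (nu x) (range (\<lambda>\<rho>. pd \<rho> nu x)))"
      by (intro vec.span_add vec.span_sum vec.span_scale vec.span_base) auto
    ultimately show False using notin by simp
  qed
  have sm_H: "smooth_fun_on D ?H"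
    unfolding second_form_def by (intro smooth_fun_on_vol[OF card_eq D] smooth_fun_on_pd sm_nu)
  define V where "V = D \<inter> ?H -` (- {0})"
  define mu where "mu = (\<lambda>y. A y $ \<alpha>0 $ \<gamma>0 * inverse (?H y))"
  have V: "open V" "x \<in> V" "V \<subseteq> D"
    using continuous_open_preimage[OF smooth_fun_on_continuous[OF sm_H] D] x Hx by (auto simp: V_def)
  have sm_mu: "smooth_fun_on V mu"
    unfolding mu_def
    by (intro smooth_fun_on_mult smooth_fun_on_inverse smooth_fun_on_subset[OF sm_H] smooth_fun_on_subset[OF sm_A] V)
      (simp add: V_def)
  from comp obtain U W where UW: "\<forall>y\<in>D. \<forall>\<alpha> \<beta> \<gamma> \<delta>.
      A y $ \<alpha> $ \<gamma> *s pd \<beta> (pd \<delta> nu) y - A y $ \<beta> $ \<delta> *s pd \<alpha> (pd \<gamma> nu) y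
      + (\<Sum>\<rho>\<in>UNIV. U \<rho> \<alpha> \<beta> \<gamma> \<delta> y *s pd \<rho> nu y) + W \<alpha> \<beta> \<gamma> \<delta> y *s nu y = 0"
    unfolding lelieuvre_compatibility_def by (elim exE)
  have A: "A y $ \<alpha> $ \<gamma> = mu y * second_form nu y \<alpha> \<gamma>" if y: "y \<in> V" for y \<alpha> \<gamma>
  proof -
    \<comment> \<open>The condition with \<open>\<alpha>0\<close>, \<open>\<gamma>0\<close> in place
      of \<open>\<beta>\<close>, \<open>\<delta>\<close>; the arguments of \<open>UW\<close> follow
      the order of occurrence \<open>\<alpha>\<close>, \<open>\<gamma>\<close>,
      \<open>\<beta>\<close>, \<open>\<delta>\<close>.\<close>
    have "A y $ \<alpha> $ \<gamma> *s pd \<alpha>0 (pd \<gamma>0 nu) y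
        + (W \<alpha> \<alpha>0 \<gamma> \<gamma>0 y *s nu y + (\<Sum>\<rho>\<in>UNIV. U \<rho> \<alpha> \<alpha>0 \<gamma> \<gamma>0 y *s pd \<rho> nu y))
        = A y $ \<alpha>0 $ \<gamma>0 *s pd \<alpha> (pd \<gamma> nu) y"
      using UW[rule_format, of y \<alpha> \<gamma> \<alpha>0 \<gamma>0] y V by (simp add: algebra_simps subset_iff)
    hence "vol (A y $ \<alpha> $ \<gamma> *s pd \<alpha>0 (pd \<gamma>0 nu) y
        + (W \<alpha> \<alpha>0 \<gamma> \<gamma>0 y *s nu y + (\<Sum>\<rho>\<in>UNIV. U \<rho> \<alpha> \<alpha>0 \<gamma> \<gamma>0 y *s pd \<rho> nu y))) (nu y) (\<lambda>\<rho>. pd \<rho> nu y)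
        = vol (A y $ \<alpha>0 $ \<gamma>0 *s pd \<alpha> (pd \<gamma> nu) y) (nu y) (\<lambda>\<rho>. pd \<rho> nu y)"
      by (rule arg_cong)
    hence "A y $ \<alpha> $ \<gamma> * ?H y = A y $ \<alpha>0 $ \<gamma>0 * second_form nu y \<alpha> \<gamma>"
      unfolding vol_add[OF card_eq, of "A y $ \<alpha> $ \<gamma> *s pd \<alpha>0 (pd \<gamma>0 nu) y"]
        vol_combination_eq_0[OF card_eq] vol_scale[OF card_eq] second_form_def by simp
    moreover have "?H y \<noteq> 0" using y by (simp add: V_def)
    ultimately show ?thesis by (simp add: mu_def field_simps)
  qed
  \<comment> \<open>A zero of \<open>mu\<close> would make \<open>A y\<close> the zero matrix, whose
    determinant vanishes.\<close>
  have "mu y \<noteq> 0" if "y \<in> V" for y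
  proof
    assume "mu y = 0"
    hence "A y = mat 0" using A[OF that] by (simp add: vec_eq_iff mat_def)
    thus False using det that V by (metis det_0 subsetD)
  qed
  thus ?thesis using A by (intro that[OF V sm_mu] ballI allI)
qed

text \<open>Only a continuous square root of \<open>mu\<close> has to be supplied; its smoothness
  follows from that of \<open>mu\<close>.\<close>

lemma solvable_atI:
  fixes nu :: "('k::real_normed_field, 'n, 'm) homog_fun"
  assumes "lelieuvre_data D A nu" "open V" "x \<in> V" "V \<subseteq> D"
    and "smooth_fun_on V mu" "\<And>y. y \<in> V \<Longrightarrow> mu y \<noteq> 0"
    and "\<And>y \<alpha> \<gamma>. y \<in> V \<Longrightarrow> A y $ \<alpha> $ \<gamma> = mu y * second_form nu y \<alpha> \<gamma>"
    and "continuous_on V lam" "\<And>y. y \<in> V \<Longrightarrow> lam y * lam y = mu y"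
  shows "lelieuvre_solvable_at D A nu x"
proof -
  have ne: "lam y \<noteq> 0" if "y \<in> V" for y using assms(6,9)[OF that] by auto
  have "smooth_fun_on V lam"
    by (rule smooth_fun_on_continuous_sqrt[OF assms(2,8) ne assms(9,5)])
  moreover have "hypersurface_on V nu"
    using assms(1) by (intro hypersurface_on_subset[OF _ assms(4)]) (simp add: lelieuvre_data_def)
  moreover have "det (A y) \<noteq> 0" if "y \<in> V" for y
    using assms(1) subsetD[OF assms(4) that] by (simp add: lelieuvre_data_def)
  ultimately have "lelieuvre_image V A nu (\<lambda>y. \<chi> i. lam y * vol (axis i 1) (nu y) (\<lambda>\<rho>. pd \<rho> nu y))"
    using ne by (intro lelieuvre_image_conormal[OF assms(2)]) (simp_all add: assms(7,9))
  with assms(2-4) show ?thesis unfolding lelieuvre_solvable_at_def by (intro exI conjI)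
qed

lemma compatibility_imp_solvable_complex:
  fixes nu :: "(complex, 'n, 'm) homog_fun"
  assumes "lelieuvre_data D A nu" "nowhere_flat_on D nu" "lelieuvre_compatibility D A nu" "x \<in> D"
  shows "lelieuvre_solvable_at D A nu x"
proof -
  obtain V mu where V: "open V" "x \<in> V" "V \<subseteq> D" and sm_mu: "smooth_fun_on V mu"
    and "\<forall>y\<in>V. mu y \<noteq> 0" "\<forall>y\<in>V. \<forall>\<alpha> \<gamma>. A y $ \<alpha> $ \<gamma> = mu y * second_form nu y \<alpha> \<gamma>"
    by (rule compatibility_factor[OF assms])
  hence mu_ne: "mu y \<noteq> 0" and A: "A y $ \<alpha> $ \<gamma> = mu y * second_form nu y \<alpha> \<gamma>"
    if "y \<in> V" for y \<alpha> \<gamma>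
    using that by simp_all
  have mux: "mu x \<noteq> 0" by (rule mu_ne[OF V(2)])
  have cont: "continuous_on V (\<lambda>y. mu y / mu x)"
    using smooth_fun_on_continuous[OF sm_mu] mux by (intro continuous_intros) auto
  \<comment> \<open>The quotient \<open>mu y / mu x\<close> is 1 at \<open>x\<close>, so near
    \<open>x\<close> it avoids the branch cut of \<open>csqrt\<close>; the factor
    \<open>csqrt (mu x)\<close> restores a square root of \<open>mu y\<close>.\<close>
  define V' where "V' = V \<inter> (\<lambda>y. mu y / mu x) -` (- \<real>\<^sub>\<le>\<^sub>0)"
  have V': "open V'" "x \<in> V'" "V' \<subseteq> V"
    using continuous_open_preimage[OF cont V(1), of "- \<real>\<^sub>\<le>\<^sub>0"] V mux
    by (auto simp: V'_def open_Compl closed_nonpos_Reals_complex)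
  have "continuous_on (- \<real>\<^sub>\<le>\<^sub>0) csqrt"
    by (auto simp: continuous_on_eq_continuous_within intro: continuous_within_csqrt)
  hence "continuous_on V' (\<lambda>y. csqrt (mu y / mu x))"
    by (rule continuous_on_compose2[OF _ continuous_on_subset[OF cont V'(3)]]) (auto simp: V'_def)
  hence "continuous_on V' (\<lambda>y. csqrt (mu y / mu x) * csqrt (mu x))"
    by (intro continuous_on_mult continuous_on_const)
  moreover have "(csqrt (mu y / mu x) * csqrt (mu x)) * (csqrt (mu y / mu x) * csqrt (mu x)) = mu y" for y
  proof -
    have "(csqrt (mu y / mu x) * csqrt (mu x))\<^sup>2 = mu y"
      using mux by (simp add: power_mult_distrib)
    thus ?thesis by (simp only: power2_eq_square)
  qed
  moreover have "V' \<subseteq> D" using V(3) V'(3) by blast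
  moreover have "mu y \<noteq> 0" "A y $ \<alpha> $ \<gamma> = mu y * second_form nu y \<alpha> \<gamma>" if "y \<in> V'" for y \<alpha> \<gamma>
    using that V'(3) mu_ne A by (simp_all add: subset_iff)
  ultimately show ?thesis
    by (intro solvable_atI[OF assms(1) V'(1,2) _ smooth_fun_on_subset[OF sm_mu V'(3)]])
qed

lemma solvable_at_real:
  fixes nu :: "(real, 'n, 'm) homog_fun"
  assumes "lelieuvre_data D A nu" "open V" "x \<in> V" "V \<subseteq> D" "smooth_fun_on V mu"
    and "\<And>y \<alpha> \<gamma>. y \<in> V \<Longrightarrow> A y $ \<alpha> $ \<gamma> = mu y * second_form nu y \<alpha> \<gamma>" "mu x > 0"
  shows "lelieuvre_solvable_at D A nu x"
proof -
  note cont = smooth_fun_on_continuous[OF assms(5)]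
  define V' where "V' = V \<inter> mu -` {0<..}"
  have V': "open V'" "x \<in> V'" "V' \<subseteq> V"
    using continuous_open_preimage[OF cont assms(2)] assms(3,7) by (auto simp: V'_def)
  have "continuous_on V' (\<lambda>y. sqrt (mu y))"
    using continuous_on_subset[OF cont V'(3)] by (rule continuous_on_real_sqrt)
  moreover have "V' \<subseteq> D" using assms(4) V'(3) by blast
  moreover have "A y $ \<alpha> $ \<gamma> = mu y * second_form nu y \<alpha> \<gamma>" if "y \<in> V'" for y \<alpha> \<gamma>
    using that V'(3) assms(6) by (simp add: subset_iff)
  moreover have "mu y \<noteq> 0" "sqrt (mu y) * sqrt (mu y) = mu y" if "y \<in> V'" for y
    using that by (simp_all add: V'_def)
  ultimately show ?thesis
    by (intro solvable_atI[OF assms(1) V'(1,2) _ smooth_fun_on_subset[OF assms(5) V'(3)]])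
qed

text \<open>If \<open>mu x\<close> is negative, the factorization is negated: \<open>- A\<close> is
  the second form times \<open>- mu\<close>, which is positive at \<open>x\<close>.\<close>

lemma compatibility_imp_solvable_real:
  fixes nu :: "(real, 'n, 'm) homog_fun"
  assumes "lelieuvre_data D A nu" "nowhere_flat_on D nu" "lelieuvre_compatibility D A nu" "x \<in> D"
  shows "lelieuvre_solvable_at D A nu x \<or> lelieuvre_solvable_at D (\<lambda>y. - A y) nu x"
proof -
  obtain V mu where V: "open V" "x \<in> V" "V \<subseteq> D" and sm_mu: "smooth_fun_on V mu"
    and "\<forall>y\<in>V. mu y \<noteq> 0" "\<forall>y\<in>V. \<forall>\<alpha> \<gamma>. A y $ \<alpha> $ \<gamma> = mu y * second_form nu y \<alpha> \<gamma>"
    by (rule compatibility_factor[OF assms])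
  hence mu_ne: "mu y \<noteq> 0" and A: "A y $ \<alpha> $ \<gamma> = mu y * second_form nu y \<alpha> \<gamma>"
    if "y \<in> V" for y \<alpha> \<gamma>
    using that by simp_all
  consider "mu x > 0" | "- mu x > 0" using mu_ne[OF V(2)] by linarith
  thus ?thesis
  proof cases
    case 1
    thus ?thesis by (intro disjI1 solvable_at_real[OF assms(1) V sm_mu A])
  next
    case 2
    have neg: "smooth_fun_on S (\<lambda>y. - g y)" if "open S" "smooth_fun_on S g"
      for S and g :: "(real, 'n) vec \<Rightarrow> real"
      using smooth_fun_on_mult[OF that(1) smooth_fun_on_const[OF that(1), of "- 1"] that(2)] by simp
    have "det (- A y) \<noteq> 0" if "y \<in> D" for y
    proof -
      \<comment> \<open>Negating every row multiplies the determinant by a power of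
        \<open>- 1\<close>, so it stays nonzero.\<close>
      have "- A y = (\<chi> i. (- 1) *s A y $ i)" by (simp add: vec_eq_iff)
      moreover have "det (\<chi> i. (- 1) *s A y $ i) = (\<Prod>i\<in>(UNIV :: 'n set). - 1) * det (\<chi> i. A y $ i)"
        by (rule det_rows_mul)
      ultimately show ?thesis using assms(1) that by (simp add: lelieuvre_data_def)
    qed
    hence "lelieuvre_data D (\<lambda>y. - A y) nu"
      using assms(1) neg by (simp add: lelieuvre_data_def)
    from solvable_at_real[OF this V neg[OF V(1) sm_mu] _ 2] show ?thesis by (simp add: A)
  qed
qed

end

theorem theorem4p2:
  assumes "CARD('m::{finite,linorder}) = CARD('n::{finite,linorder}) + 2"
  shows
    "(\<forall>(D :: (complex, 'n) vec set) A (nu :: (complex, 'n, 'm) homog_fun).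
        lelieuvre_data D A nu \<longrightarrow>
          ((\<forall>x\<in>D. lelieuvre_solvable_at D A nu x) \<longrightarrow> lelieuvre_compatibility D A nu) \<and>
          (nowhere_flat_on D nu \<longrightarrow> lelieuvre_compatibility D A nu \<longrightarrow>
            (\<forall>x\<in>D. lelieuvre_solvable_at D A nu x))) \<and>
     (\<forall>(D :: (real, 'n) vec set) A (nu :: (real, 'n, 'm) homog_fun).
        lelieuvre_data D A nu \<longrightarrow>
          ((\<forall>x\<in>D. lelieuvre_solvable_at D A nu x) \<longrightarrow> lelieuvre_compatibility D A nu) \<and>
          (nowhere_flat_on D nu \<longrightarrow> lelieuvre_compatibility D A nu \<longrightarrow>
            (\<forall>x\<in>D. lelieuvre_solvable_at D A nu x \<or>
                   lelieuvre_solvable_at D (\<lambda>y. - A y) nu x)))"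
  by (intro conjI allI impI ballI)
    (rule solvable_imp_compatibility[OF assms] compatibility_imp_solvable_complex[OF assms]
        compatibility_imp_solvable_real[OF assms]; assumption)+

end
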